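(* For every $n\ge 1$, the poset $\widehat{\Pi_n^w}=\Pi_n^w\cup\{\hat 1\}$, obtained by adjoining a maximum element to the poset of weighted partitions of $\{1,\dots,n\}$, is Cohen–Macaulay; that is, $\tilde H_i((x,y);\mathbf k)=0$ for all $x<y$ in $\widehat{\Pi_n^w}$ and all $i<l([x,y])-2$.
   Context: Let $[n]=\{1,\dots,n\}$. A weighted partition of $[n]$ is a set $\{B_1^{v_1},\dots,B_t^{v_t}\}$ where $\{B_1,\dots,B_t\}$ is a partition of $[n]$ and $v_i\in\{0,1,\dots,|B_i|-1\}$ for all $i$. The poset $\Pi_n^w$ is the set of weighted partitions of $[n]$ ordered by: $\{A_1^{w_1},\dots,A_s^{w_s}\}\le\{B_1^{v_1},\dots,B_t^{v_t}\}$ iff (a) $\{A_1,\dots,A_s\}$ refines $\{B_1,\dots,B_t\}$, and (b) whenever $B_k=A_{i_1}\cup\cdots\cup A_{i_l}$, then $v_k-(w_{i_1}+\cdots+w_{i_l})\in\{0,1,\dots,l-1\}$. $\widehat{\Pi_n^w}$ is obtained by adjoining an element $\hat 1$ above all others. $\mathbf k$ is an arbitrary field or the ring $\mathbb Z$. For a poset $P$, $\tilde H_i(P;\mathbf k)$ is the reduced simplicial homology of the order complex of $P$ (the simplicial complex whose faces are the chains of $P$; the empty chain is the face of dimension $-1$). $(x,y)$ and $[x,y]$ denote open and closed intervals, and $l(Q)$ is the length of the longest chain of $Q$, where a chain $s_0<\dots<s_m$ has length $m$. *)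

theory Defs
  imports
    "HOL-Library.Disjoint_Sets"
    "HOL-Library.Poly_Mapping"
    "HOL-Algebra.Elementary_Groups"
begin

section \<open>Reduced simplicial homology of order complexes\<close>

text \<open>
  Posets are given by reflexive order relations \<open>r :: 'a rel\<close>; a subposet is given by a set
  \<open>Q \<subseteq> Field r\<close> with the restricted order.
\<close>

definition order_complex :: "'a rel \<Rightarrow> 'a set \<Rightarrow> 'a set set" where
  "order_complex r Q = {\<sigma>. finite \<sigma> \<and> \<sigma> \<subseteq> Q \<and> \<sigma> \<in> Chains r}"

text \<open>
  Dimensions are integers, so that the empty chain is the face of dimension -1 and there are no
  faces in smaller dimensions.
\<close>

definition faces :: "'a rel \<Rightarrow> 'a set \<Rightarrow> int \<Rightarrow> 'a set set" where
  "faces r Q i = {\<sigma> \<in> order_complex r Q. int (card \<sigma>) = i + 1}"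

text \<open>
  The free module with basis the \<open>i\<close>-dimensional faces. Only its additive group is recorded,
  which suffices to express the vanishing of homology.
\<close>

definition simplicial_chain_group ::
    "'a rel \<Rightarrow> 'a set \<Rightarrow> int \<Rightarrow> ('a set \<Rightarrow>\<^sub>0 'k::comm_ring_1) monoid" where
  "simplicial_chain_group r Q i =
     \<lparr>carrier = {c. Poly_Mapping.keys c \<subseteq> faces r Q i},
      monoid.mult = (+), one = 0\<rparr>"

text \<open>
  For a face \<open>s\<^sub>0 < \<dots> < s\<^sub>m\<close> and \<open>x = s\<^sub>j\<close>, the number of vertices of the face strictly below
  \<open>x\<close> is \<open>j\<close>, so this is the usual alternating sum. A vertex is mapped to the empty face.
\<close>

definition boundary_map :: "'a rel \<Rightarrow> ('a set \<Rightarrow>\<^sub>0 'k::comm_ring_1) \<Rightarrow> ('a set \<Rightarrow>\<^sub>0 'k)" where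
  "boundary_map r c =
     (\<Sum>\<sigma>\<in>Poly_Mapping.keys c. \<Sum>x\<in>\<sigma>.
        Poly_Mapping.single (\<sigma> - {x})
          ((-1) ^ card (\<sigma> \<inter> underS r x) * Poly_Mapping.lookup c \<sigma>))"

definition simplicial_cycles ::
    "'a rel \<Rightarrow> 'a set \<Rightarrow> int \<Rightarrow> ('a set \<Rightarrow>\<^sub>0 'k::comm_ring_1) set" where
  "simplicial_cycles r Q i =
     kernel (simplicial_chain_group r Q i) (simplicial_chain_group r Q (i - 1)) (boundary_map r)"

definition simplicial_boundaries ::
    "'a rel \<Rightarrow> 'a set \<Rightarrow> int \<Rightarrow> ('a set \<Rightarrow>\<^sub>0 'k::comm_ring_1) set" where
  "simplicial_boundaries r Q i = boundary_map r ` carrier (simplicial_chain_group r Q (i + 1))"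

definition reduced_poset_homology ::
    "'a rel \<Rightarrow> 'a set \<Rightarrow> int \<Rightarrow> ('a set \<Rightarrow>\<^sub>0 'k::comm_ring_1) set monoid" where
  "reduced_poset_homology r Q i =
     subgroup_generated (simplicial_chain_group r Q i) (simplicial_cycles r Q i)
       Mod simplicial_boundaries r Q i"


section \<open>Cohen--Macaulay posets\<close>

definition open_interval :: "'a rel \<Rightarrow> 'a \<Rightarrow> 'a \<Rightarrow> 'a set" where
  "open_interval r x y = aboveS r x \<inter> underS r y"

definition closed_interval :: "'a rel \<Rightarrow> 'a \<Rightarrow> 'a \<Rightarrow> 'a set" where
  "closed_interval r x y = above r x \<inter> under r y"

text \<open>Meaningful for finite \<open>Q\<close>; the empty poset has length -1.\<close>

definition poset_length :: "'a rel \<Rightarrow> 'a set \<Rightarrow> int" where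
  "poset_length r Q = int (Max (card ` order_complex r Q)) - 1"

text \<open>The type argument is the coefficient ring.\<close>

definition Cohen_Macaulay :: "'k::comm_ring_1 itself \<Rightarrow> 'a rel \<Rightarrow> bool" where
  "Cohen_Macaulay _ r \<longleftrightarrow>
     (\<forall>x y i. (x, y) \<in> r \<and> x \<noteq> y \<and> i < poset_length r (closed_interval r x y) - 2 \<longrightarrow>
        trivial_group
          (reduced_poset_homology r (open_interval r x y) i :: ('a set \<Rightarrow>\<^sub>0 'k) set monoid))"


section \<open>The poset of weighted partitions\<close>

text \<open>A weighted block \<open>B\<^sup>v\<close> is the pair \<open>(B, v)\<close>.\<close>

definition weighted_partitions :: "nat \<Rightarrow> (nat set \<times> nat) set set" where
  "weighted_partitions n =
     {\<alpha>. partition_on {1..n} (fst ` \<alpha>) \<and> inj_on fst \<alpha> \<and> (\<forall>(B, v)\<in>\<alpha>. v \<in> {0..card B - 1})}"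

definition weighted_partition_order :: "nat \<Rightarrow> (nat set \<times> nat) set rel" where
  "weighted_partition_order n =
     {(\<alpha>, \<beta>). \<alpha> \<in> weighted_partitions n \<and> \<beta> \<in> weighted_partitions n \<and>
        refines {1..n} (fst ` \<alpha>) (fst ` \<beta>) \<and>
        (\<forall>(B, v)\<in>\<beta>. \<forall>S\<subseteq>\<alpha>. B = \<Union>(fst ` S) \<longrightarrow>
           int v - (\<Sum>(A, w)\<in>S. int w) \<in> {0..int (card S) - 1})}"

text \<open>The adjoined maximum is \<open>None\<close>.\<close>

definition adjoin_top :: "'a set \<Rightarrow> 'a rel \<Rightarrow> 'a option rel" where
  "adjoin_top P r = {(Some x, Some y) | x y. (x, y) \<in> r} \<union> (insert None (Some ` P)) \<times> {None}"

definition weighted_partition_order_top :: "nat \<Rightarrow> (nat set \<times> nat) set option rel" where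
  "weighted_partition_order_top n =
     adjoin_top (weighted_partitions n) (weighted_partition_order n)"

end

theory Submission
  imports Defs
begin

text \<open>
  A cover relation below the maximum merges two blocks with minima \<open>a < b\<close> and increases the
  total weight by \<open>u \<in> {0, 1}\<close>; it is labelled \<open>(a, b, u)\<close>. Two consecutive steps
  \<open>(a, b, u)\<close>, \<open>(a', b', u')\<close> form an ascent if \<open>a < a'\<close>, or \<open>a = a'\<close>,
  \<open>b \<le> b'\<close> and \<open>u \<le> u'\<close>. Every interval has a unique ascending maximal chain, and
  replacing the middle element of a descent can always lower the label sequence lexicographically.
  Hence the maximal chains of an interval, ordered by their label sequences, form a shelling of its
  order complex: a maximal chain adds exactly the faces that contain all its descents. Since those
  faces cancel in pairs unless all inner elements are descents, every cycle below the top
  dimension can be pushed off the chains one after the other and is a boundary.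
\<close>

section \<open>Acyclicity of simplicial complexes\<close>

text \<open>Uniqueness of ascending chains dictates the shape of the ascent condition. If
  \<open>(b, u)\<close> were compared lexicographically for equal \<open>a\<close>, then (a, b, 0),
  (a, b', 1) and (a, b, 1), (a, b', 0) with b < b' would both ascend, and they lead to the same
  partition. So \<open>b\<close> and \<open>u\<close> have to increase weakly each on its own, while
  label sequences are still compared by a total order. For a target block whose subblocks number c
  and have total weight W, the possible weights form the range W, ..., W + c - 1. A merge inside the
  block removes the largest value if \<open>u = 0\<close> and the smallest if \<open>u = 1\<close>.
  The target weight therefore fixes the number of ones, and an ascending chain has to place the
  zeros of each block before its ones. The homological part only uses that the signs in the boundary
  are units; nothing is divided, so one argument over commutative rings covers fields and the
  integers alike.\<close>

definition face_sign :: "'a rel \<Rightarrow> 'a set \<Rightarrow> 'a \<Rightarrow> 'k::comm_ring_1" where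
  "face_sign r \<sigma> x = (-1) ^ card (\<sigma> \<inter> underS r x)"

lemma face_sign_square [simp]: "face_sign r \<sigma> x * face_sign r \<sigma> x = (1 :: 'k::comm_ring_1)"
  by (simp add: face_sign_def flip: power_mult_distrib)

text \<open>Signs are units, so they can be cancelled even in a coefficient ring with zero
  divisors.\<close>

lemma face_sign_mult_eq_0_iff [simp]:
  "face_sign r \<sigma> x * c = 0 \<longleftrightarrow> c = (0 :: 'k::comm_ring_1)"
  by (metis face_sign_square mult.assoc mult.left_neutral mult_zero_right)

text \<open>The defining sum runs over \<open>keys c\<close>, which depends on \<open>c\<close>, so
  linearity is not visible there. Collecting the coefficient of a fixed face over the vertices that
  can be added to it gives a formula with a fixed index set.\<close>

lemma lookup_boundary_map:
  fixes c :: "'a set \<Rightarrow>\<^sub>0 'k::comm_ring_1"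
  assumes Q: "finite Q" and c: "Poly_Mapping.keys c \<subseteq> Pow Q"
  shows "Poly_Mapping.lookup (boundary_map r c) \<sigma> =
    (\<Sum>x\<in>Q - \<sigma>. face_sign r (insert x \<sigma>) x * Poly_Mapping.lookup c (insert x \<sigma>))"
proof -
  let ?g = "\<lambda>\<tau> x. face_sign r \<tau> x * Poly_Mapping.lookup c \<tau>"
  have "Poly_Mapping.lookup (boundary_map r c) \<sigma> =
      (\<Sum>\<tau>\<in>Poly_Mapping.keys c. \<Sum>x\<in>\<tau>. if \<tau> - {x} = \<sigma> then ?g \<tau> x else 0)"
    unfolding boundary_map_def lookup_sum lookup_single when_def face_sign_def by (rule refl)
  also have "\<dots> = (\<Sum>\<tau>\<in>Poly_Mapping.keys c. \<Sum>x\<in>Q. if x \<in> \<tau> \<and> \<tau> - {x} = \<sigma> then ?g \<tau> x else 0)"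
  proof (rule sum.cong[OF refl])
    fix \<tau> assume "\<tau> \<in> Poly_Mapping.keys c"
    then have "\<tau> \<subseteq> Q"
      using c by blast
    then show "(\<Sum>x\<in>\<tau>. if \<tau> - {x} = \<sigma> then ?g \<tau> x else 0) =
        (\<Sum>x\<in>Q. if x \<in> \<tau> \<and> \<tau> - {x} = \<sigma> then ?g \<tau> x else 0)"
      using Q by (intro sum.mono_neutral_cong_left) auto
  qed
  also have "\<dots> = (\<Sum>x\<in>Q. \<Sum>\<tau>\<in>Poly_Mapping.keys c. if x \<in> \<tau> \<and> \<tau> - {x} = \<sigma> then ?g \<tau> x else 0)"
    by (rule sum.swap)
  also have "\<dots> = (\<Sum>x\<in>Q. if x \<in> \<sigma> then 0 else ?g (insert x \<sigma>) x)"
  proof (rule sum.cong[OF refl])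
    fix x
    show "(\<Sum>\<tau>\<in>Poly_Mapping.keys c. if x \<in> \<tau> \<and> \<tau> - {x} = \<sigma> then ?g \<tau> x else 0) =
      (if x \<in> \<sigma> then 0 else ?g (insert x \<sigma>) x)"
    proof (cases "x \<in> \<sigma>")
      case True
      then show ?thesis by (auto intro: sum.neutral)
    next
      case False
      then have "(x \<in> \<tau> \<and> \<tau> - {x} = \<sigma>) \<longleftrightarrow> \<tau> = insert x \<sigma>" for \<tau>
        by auto
      then show ?thesis
        using False by (simp add: in_keys_iff)
    qed
  qed
  also have "\<dots> = (\<Sum>x\<in>Q - \<sigma>. ?g (insert x \<sigma>) x)"
    using Q by (intro sum.mono_neutral_cong_right) auto
  finally show ?thesis .
qed

lemma boundary_map_add:
  fixes c d :: "'a set \<Rightarrow>\<^sub>0 'k::comm_ring_1"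
  assumes Q: "finite Q" and c: "Poly_Mapping.keys c \<subseteq> Pow Q" and d: "Poly_Mapping.keys d \<subseteq> Pow Q"
  shows "boundary_map r (c + d) = boundary_map r c + boundary_map r d"
proof (rule poly_mapping_eqI)
  have "Poly_Mapping.keys (c + d) \<subseteq> Pow Q"
    using keys_add[of c d] c d by blast
  then show "Poly_Mapping.lookup (boundary_map r (c + d)) \<sigma> = Poly_Mapping.lookup (boundary_map r c + boundary_map r d) \<sigma>" for \<sigma>
    by (simp add: lookup_add lookup_boundary_map[OF Q] c d distrib_left sum.distrib)
qed

lemma boundary_map_uminus:
  fixes c :: "'a set \<Rightarrow>\<^sub>0 'k::comm_ring_1"
  assumes Q: "finite Q" and c: "Poly_Mapping.keys c \<subseteq> Pow Q"
  shows "boundary_map r (- c) = - boundary_map r c"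
  by (rule poly_mapping_eqI)
    (simp add: lookup_boundary_map[OF Q] c sum_negf)

lemma boundary_map_diff:
  fixes c d :: "'a set \<Rightarrow>\<^sub>0 'k::comm_ring_1"
  assumes "finite Q" and "Poly_Mapping.keys c \<subseteq> Pow Q" and "Poly_Mapping.keys d \<subseteq> Pow Q"
  shows "boundary_map r (c - d) = boundary_map r c - boundary_map r d"
  using assms boundary_map_add[of Q c "- d" r] boundary_map_uminus[of Q d r] by simp

lemma boundary_map_0 [simp]: "boundary_map r 0 = 0"
  by (simp add: boundary_map_def)

lemma faces_subset_Pow: "faces r Q i \<subseteq> Pow Q"
  by (auto simp: faces_def order_complex_def)

lemma order_complex_mono: "\<sigma> \<in> order_complex r Q \<Longrightarrow> \<tau> \<subseteq> \<sigma> \<Longrightarrow> \<tau> \<in> order_complex r Q"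
  by (auto simp: order_complex_def Chains_def dest: finite_subset)

lemma keys_boundary_map:
  fixes c :: "'a set \<Rightarrow>\<^sub>0 'k::comm_ring_1"
  assumes Q: "finite Q" and c: "Poly_Mapping.keys c \<subseteq> faces r Q i"
  shows "Poly_Mapping.keys (boundary_map r c) \<subseteq> faces r Q (i - 1)"
proof
  fix \<sigma> assume "\<sigma> \<in> Poly_Mapping.keys (boundary_map r c)"
  then obtain x where x: "x \<in> Q - \<sigma>" "Poly_Mapping.lookup c (insert x \<sigma>) \<noteq> 0"
    using lookup_boundary_map[OF Q, of c r \<sigma>] c faces_subset_Pow[of r Q i]
    by (force simp: in_keys_iff intro: sum.neutral)
  then have "insert x \<sigma> \<in> faces r Q i"
    using c by (auto simp: in_keys_iff)
  then have *: "insert x \<sigma> \<in> order_complex r Q" and "int (card (insert x \<sigma>)) = i + 1" "finite \<sigma>"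
    by (auto simp: faces_def order_complex_def)
  then have "int (card \<sigma>) = i"
    using x by auto
  then show "\<sigma> \<in> faces r Q (i - 1)"
    using order_complex_mono[OF *, of \<sigma>] by (auto simp: faces_def)
qed

lemma boundary_map_boundary_map:
  fixes c :: "'a set \<Rightarrow>\<^sub>0 'k::comm_ring_1"
  assumes Q: "finite Q" and r: "antisym r" and c: "Poly_Mapping.keys c \<subseteq> faces r Q i"
  shows "boundary_map r (boundary_map r c) = 0"
proof (rule poly_mapping_eqI)
  fix \<sigma>
  have c': "Poly_Mapping.keys c \<subseteq> Pow Q" "Poly_Mapping.keys (boundary_map r c) \<subseteq> Pow Q"
    using c keys_boundary_map[OF Q c] faces_subset_Pow by blast+
  define f where "f x y = (face_sign r (insert x \<sigma>) x * face_sign r (insert y (insert x \<sigma>)) y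
    * Poly_Mapping.lookup c (insert y (insert x \<sigma>)) :: 'k)" for x y
  \<comment> \<open>\<open>f x y\<close> is the contribution of adding \<open>x\<close> and then
    \<open>y\<close> to the face. The lower vertex \<open>x\<close> is counted in the sign of
    \<open>y\<close> exactly when it is already present, whereas \<open>y\<close> never affects the
    sign of \<open>x\<close>; hence one extra factor -1.\<close>
  have f: "f x y = - f y x" if "x \<notin> \<sigma>" "y \<notin> \<sigma>" "(x, y) \<in> r" "x \<noteq> y" for x y
  proof (cases "insert y (insert x \<sigma>) \<in> Poly_Mapping.keys c")
    case True
    then have "finite \<sigma>"
      using c by (auto simp: faces_def order_complex_def)
    have nyx: "(y, x) \<notin> r"
      using that r by (auto dest: antisymD)
    have "insert y (insert x \<sigma>) \<inter> underS r y = insert x (insert y \<sigma> \<inter> underS r y)"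
      using that by (auto simp: underS_def)
    then have "card (insert y (insert x \<sigma>) \<inter> underS r y) = Suc (card (insert y \<sigma> \<inter> underS r y))"
      using that \<open>finite \<sigma>\<close> by simp
    moreover have "insert x (insert y \<sigma>) \<inter> underS r x = insert x \<sigma> \<inter> underS r x"
      using nyx by (auto simp: underS_def)
    ultimately show ?thesis
      unfolding f_def face_sign_def insert_commute[of y x] by (simp add: mult.assoc mult.left_commute)
  next
    case False
    then show ?thesis
      by (simp add: f_def in_keys_iff insert_commute[of y x])
  qed
  \<comment> \<open>Incomparable vertices share no face. The remaining ordered pairs split into two
    halves \<open>?A\<close> and \<open>?B\<close> that are exchanged by swapping and
    cancel.\<close>
  have f0: "f x y = 0" if "(x, y) \<notin> r" "(y, x) \<notin> r" for x y
  proof -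
    have "insert y (insert x \<sigma>) \<notin> Poly_Mapping.keys c"
      using c that by (auto simp: faces_def order_complex_def Chains_def)
    then show ?thesis by (simp add: f_def in_keys_iff)
  qed
  let ?D = "Q - \<sigma>"
  let ?A = "{(x, y). x \<in> ?D \<and> y \<in> ?D \<and> x \<noteq> y \<and> (x, y) \<in> r}"
  let ?B = "{(x, y). x \<in> ?D \<and> y \<in> ?D \<and> x \<noteq> y \<and> (y, x) \<in> r}"
  have fin: "finite ?A" "finite ?B"
    by (rule finite_subset[of _ "Q \<times> Q"]; use Q in auto)+
  have "Poly_Mapping.lookup (boundary_map r (boundary_map r c)) \<sigma> = (\<Sum>x\<in>?D. \<Sum>y\<in>?D - {x}. f x y)"
    unfolding lookup_boundary_map[OF Q c'(2)]
  proof (rule sum.cong[OF refl])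
    fix x
    show "face_sign r (insert x \<sigma>) x * Poly_Mapping.lookup (boundary_map r c) (insert x \<sigma>) =
        (\<Sum>y\<in>?D - {x}. f x y)"
      by (simp only: lookup_boundary_map[OF Q c'(1)] sum_distrib_left Diff_insert[of Q x \<sigma>] f_def mult.assoc)
  qed
  also have "\<dots> = (\<Sum>(x, y)\<in>Sigma ?D (\<lambda>x. ?D - {x}). f x y)"
    by (rule sum.Sigma) (use Q in simp_all)
  also have "\<dots> = (\<Sum>(x, y)\<in>?A \<union> ?B. f x y)"
  proof (intro sum.mono_neutral_right ballI)
    fix p assume "p \<in> Sigma ?D (\<lambda>x. ?D - {x}) - (?A \<union> ?B)"
    then show "(case p of (x, y) \<Rightarrow> f x y) = 0"
      using f0 by (cases p) auto
  qed (use Q in auto)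
  also have "\<dots> = (\<Sum>(x, y)\<in>?A. f x y) + (\<Sum>(x, y)\<in>?B. f x y)"
    using fin r by (intro sum.union_disjoint) (auto dest: antisymD)
  also have "(\<Sum>(x, y)\<in>?B. f x y) = (\<Sum>(x, y)\<in>?A. f y x)"
    by (rule sum.reindex_bij_witness[of _ prod.swap prod.swap]) auto
  also have "\<dots> = (\<Sum>(x, y)\<in>?A. - f x y)"
    using f by (intro sum.cong refl) (clarsimp; blast)
  finally show "Poly_Mapping.lookup (boundary_map r (boundary_map r c)) \<sigma> = Poly_Mapping.lookup 0 \<sigma>"
    by (simp add: case_prod_unfold sum_negf)
qed

section \<open>Triviality of homology groups\<close>

lemma group_simplicial_chain_group:
  "group (simplicial_chain_group r Q i :: ('a set \<Rightarrow>\<^sub>0 'k::comm_ring_1) monoid)"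
proof (rule groupI)
  fix c d :: "'a set \<Rightarrow>\<^sub>0 'k"
  assume c: "c \<in> carrier (simplicial_chain_group r Q i)"
  show "\<exists>y\<in>carrier (simplicial_chain_group r Q i).
      y \<otimes>\<^bsub>simplicial_chain_group r Q i\<^esub> c = \<one>\<^bsub>simplicial_chain_group r Q i\<^esub>"
    using c by (intro bexI[of _ "- c"]) (auto simp: simplicial_chain_group_def)
  assume d: "d \<in> carrier (simplicial_chain_group r Q i)"
  show "c \<otimes>\<^bsub>simplicial_chain_group r Q i\<^esub> d \<in> carrier (simplicial_chain_group r Q i)"
    using c d keys_add[of c d] by (auto simp: simplicial_chain_group_def)
qed (auto simp: simplicial_chain_group_def add.assoc)

lemma simplicial_cycles_eq:
  "simplicial_cycles r Q i = {c. Poly_Mapping.keys c \<subseteq> faces r Q i \<and> boundary_map r c = 0}"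
  by (auto simp: simplicial_cycles_def kernel_def simplicial_chain_group_def)

lemma (in group) trivial_group_Mod_carrier: "trivial_group (G Mod carrier G)"
proof -
  have "group (G Mod carrier G)"
    by (intro normal.factorgroup_is_group normal_invI subgroup_self) auto
  moreover have "carrier (G Mod carrier G) = {carrier G}"
    using one_closed by (auto simp: FactGroup_def RCOSETS_def coset_join2 subgroup_self)
  ultimately show ?thesis
    by (simp add: trivial_group_def FactGroup_def)
qed

text \<open>Boundaries are cycles in any case, so filling every cycle makes the two groups equal,
  and a group modulo itself is trivial.\<close>

lemma trivial_reduced_poset_homology:
  fixes k :: "'k::comm_ring_1 itself"
  assumes Q: "finite Q" and r: "antisym r"
    and ex: "\<And>z. Poly_Mapping.keys z \<subseteq> faces r Q i \<Longrightarrow> boundary_map r z = 0 \<Longrightarrow>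
      \<exists>w. Poly_Mapping.keys w \<subseteq> faces r Q (i + 1) \<and> boundary_map r w = (z :: 'a set \<Rightarrow>\<^sub>0 'k)"
  shows "trivial_group (reduced_poset_homology r Q i :: ('a set \<Rightarrow>\<^sub>0 'k) set monoid)"
proof -
  let ?G = "simplicial_chain_group r Q i :: ('a set \<Rightarrow>\<^sub>0 'k) monoid"
  let ?Z = "simplicial_cycles r Q i :: ('a set \<Rightarrow>\<^sub>0 'k) set"
  interpret G: group ?G
    by (rule group_simplicial_chain_group)
  note P = subset_trans[OF _ faces_subset_Pow]
  have "subgroup ?Z ?G"
  proof (rule G.subgroupI)
    show "?Z \<subseteq> carrier ?G"
      by (auto simp: simplicial_cycles_eq simplicial_chain_group_def)
    have "0 \<in> ?Z"
      by (simp add: simplicial_cycles_eq)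
    then show "?Z \<noteq> {}" by blast
    fix a b assume a: "a \<in> ?Z" 
    have "- a \<otimes>\<^bsub>?G\<^esub> a = \<one>\<^bsub>?G\<^esub>"
      by (simp add: simplicial_chain_group_def)
    then have "inv\<^bsub>?G\<^esub> a = - a"
      using a by (intro G.inv_equality)
        (auto simp: simplicial_cycles_eq simplicial_chain_group_def)
    then show "inv\<^bsub>?G\<^esub> a \<in> ?Z"
      using a by (auto simp: simplicial_cycles_eq boundary_map_uminus[OF Q P])
    assume b: "b \<in> ?Z"
    show "a \<otimes>\<^bsub>?G\<^esub> b \<in> ?Z"
      using a b keys_add[of a b]
      by (auto simp: simplicial_cycles_eq simplicial_chain_group_def boundary_map_add[OF Q P P])
  qed
  then interpret H: subgroup ?Z ?G .
  interpret H: group "subgroup_generated ?G ?Z"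
    by (rule G.group_subgroup_generated)
  have "simplicial_boundaries r Q i = ?Z"
  proof
    show "simplicial_boundaries r Q i \<subseteq> ?Z"
      using keys_boundary_map[OF Q, of _ r "i + 1"] boundary_map_boundary_map[OF Q r, of _ "i + 1"]
      by (auto simp: simplicial_boundaries_def simplicial_chain_group_def simplicial_cycles_eq)
    show "?Z \<subseteq> simplicial_boundaries r Q i"
      using ex by (fastforce simp: simplicial_boundaries_def simplicial_chain_group_def simplicial_cycles_eq)
  qed
  then show ?thesis
    using H.trivial_group_Mod_carrier
    by (simp add: reduced_poset_homology_def)
qed

text \<open>
  Adding the facets in the order of \<open>\<mu>\<close>, the facet \<open>V f\<close> contributes precisely the faces between
  its restriction set \<open>R\<close> and \<open>V f\<close>. Unless \<open>R = V f\<close>, these are paired off by a vertex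
  in \<open>V f - R\<close>.
\<close>

definition shelling_restriction :: "'b set \<Rightarrow> ('b \<Rightarrow> 'a set) \<Rightarrow> ('b \<Rightarrow> nat) \<Rightarrow> 'b \<Rightarrow> 'a set" where
  "shelling_restriction J V \<mu> f = {v \<in> V f. \<exists>g\<in>J. \<mu> g < \<mu> f \<and> V f - {v} \<subseteq> V g}"

text \<open>Induction over initial segments \<open>I\<close> of the facets: a cycle supported on
  \<open>I\<close> is changed by a boundary until it avoids the last facet. As \<mu> may have ties,
  the shelling condition is imposed for \<open>\<mu> g \<le> \<mu> f\<close>, although the
  restriction set only looks at strictly earlier facets.\<close>

lemma shellable_cycle_is_boundary:
  fixes z :: "'a set \<Rightarrow>\<^sub>0 'k::comm_ring_1" and \<mu> :: "'b \<Rightarrow> nat"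
  assumes Q: "finite Q" and r: "antisym r" and J: "finite J"
    and complex: "order_complex r Q = {\<sigma>. \<exists>f\<in>J. \<sigma> \<subseteq> V f}"
    and dim: "\<And>f. f \<in> J \<Longrightarrow> i + 1 < int (card (V f))"
    and shelling: "\<And>f g. f \<in> J \<Longrightarrow> g \<in> J \<Longrightarrow> f \<noteq> g \<Longrightarrow> \<mu> g \<le> \<mu> f \<Longrightarrow>
      \<exists>v\<in>shelling_restriction J V \<mu> f. v \<notin> V g"
    and z: "Poly_Mapping.keys z \<subseteq> faces r Q i" "boundary_map r z = 0"
  shows "\<exists>w. Poly_Mapping.keys w \<subseteq> faces r Q (i + 1) \<and> boundary_map r w = z"
proof -
  let ?\<Delta> = "\<lambda>I. {\<sigma>. \<exists>f\<in>I. \<sigma> \<subseteq> V f}"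
  have "\<exists>w. Poly_Mapping.keys w \<subseteq> faces r Q (i + 1) \<and> boundary_map r w = z"
    if "I \<subseteq> J" "\<And>f g. f \<in> I \<Longrightarrow> g \<in> J \<Longrightarrow> \<mu> g < \<mu> f \<Longrightarrow> g \<in> I"
      "Poly_Mapping.keys z \<subseteq> faces r Q i" "Poly_Mapping.keys z \<subseteq> ?\<Delta> I" "boundary_map r z = 0"
    for I and z :: "'a set \<Rightarrow>\<^sub>0 'k"
    using that
  proof (induction "card I" arbitrary: I z)
    case 0
    then have "I = {}"
      using J finite_subset by fastforce
    with 0 have "z = 0"
      by auto
    then show ?case
      by (intro exI[of _ 0]) auto
  next
    case (Suc m I z)
    have "finite I"
      using Suc.prems(1) J by (rule finite_subset)
    have "I \<noteq> {}"
      using Suc.hyps(2) by auto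
    have "Max (\<mu> ` I) \<in> \<mu> ` I"
      using \<open>finite I\<close> \<open>I \<noteq> {}\<close> by (intro Max_in) auto
    then obtain f where f: "f \<in> I" and "Max (\<mu> ` I) = \<mu> f"
      by blast
    then have f_max: "\<mu> g \<le> \<mu> f" if "g \<in> I" for g
      using \<open>finite I\<close> that Max_ge[of "\<mu> ` I" "\<mu> g"] by simp
    let ?R = "shelling_restriction J V \<mu> f"
    let ?I = "I - {f}"
    \<comment> \<open>These are the faces lost with \<open>f\<close>. A face that misses some
      \<open>v\<close> in \<open>?R\<close> survives in the earlier facet containing
      \<open>V f - {v}\<close>; a face containing \<open>?R\<close> lies in no other facet of
      \<open>I\<close> by the shelling condition.\<close>
    have new: "\<sigma> \<notin> ?\<Delta> ?I \<longleftrightarrow> ?R \<subseteq> \<sigma>" if "\<sigma> \<subseteq> V f" for \<sigma>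
    proof
      assume *: "\<sigma> \<notin> ?\<Delta> ?I"
      show "?R \<subseteq> \<sigma>"
      proof
        fix v assume "v \<in> ?R"
        then obtain g where g: "g \<in> J" "\<mu> g < \<mu> f" "V f - {v} \<subseteq> V g"
          by (auto simp: shelling_restriction_def)
        then have "g \<in> ?I"
          using Suc.prems(2)[OF f] by auto
        then show "v \<in> \<sigma>"
          using * that g by auto
      qed
    next
      assume *: "?R \<subseteq> \<sigma>"
      have "\<not> \<sigma> \<subseteq> V g" if "g \<in> ?I" for g
        using shelling[of f g] that f f_max Suc.prems(1) * by blast
      then show "\<sigma> \<notin> ?\<Delta> ?I" by auto
    qed
    have IH: "\<exists>w. Poly_Mapping.keys w \<subseteq> faces r Q (i + 1) \<and> boundary_map r w = y"
      if "Poly_Mapping.keys y \<subseteq> faces r Q i" "Poly_Mapping.keys y \<subseteq> ?\<Delta> ?I" "boundary_map r y = 0"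
      for y :: "'a set \<Rightarrow>\<^sub>0 'k"
    proof (rule Suc.hyps(1)[of ?I y])
      show "m = card ?I"
        using Suc.hyps(2) f by simp
      show "g \<in> ?I" if "h \<in> ?I" "g \<in> J" "\<mu> g < \<mu> h" for g h
        using that Suc.prems(2)[of h g] f_max[of h] by auto
    qed (use that Suc.prems in auto)
    have finV: "finite (V f)" and VQ: "V f \<subseteq> Q"
      using complex f Suc.prems(1) by (auto simp: order_complex_def)
    have card_face: "int (card \<sigma>) = i + 1" if "\<sigma> \<in> Poly_Mapping.keys z" for \<sigma>
      using that Suc.prems by (auto simp: faces_def)
    have zP: "Poly_Mapping.keys z \<subseteq> Pow Q"
      using Suc.prems(3) faces_subset_Pow by blast
    show ?case
    proof (cases "?R = V f")
      \<comment> \<open>Only the facet itself is lost, and it has more than \<open>i + 1\<close>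
        vertices, so it cannot occur in \<open>z\<close>.\<close>
      case True
      have "Poly_Mapping.keys z \<subseteq> ?\<Delta> ?I"
      proof
        fix \<sigma> assume \<sigma>: "\<sigma> \<in> Poly_Mapping.keys z"
        show "\<sigma> \<in> ?\<Delta> ?I"
        proof (rule ccontr)
          assume *: "\<sigma> \<notin> ?\<Delta> ?I"
          then have "\<sigma> \<subseteq> V f"
            using Suc.prems(4) \<sigma> by auto
          with new * True have "\<sigma> = V f"
            by auto
          then show False
            using card_face[OF \<sigma>] dim[of f] f Suc.prems(1) by auto
        qed
      qed
      then show ?thesis
        using IH Suc.prems by blast
    next
      case False
      then obtain x where x: "x \<in> V f" "x \<notin> ?R"
        by (auto simp: shelling_restriction_def)
      \<comment> \<open>The lost faces are paired by adding or removing \<open>x\<close>;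
        \<open>S\<close> holds the smaller member of each pair.\<close>
      define S where "S = {\<sigma>. ?R \<subseteq> \<sigma> \<and> \<sigma> \<subseteq> V f \<and> x \<notin> \<sigma>}"
      have "finite S"
        by (rule finite_subset[of _ "Pow (V f)"]) (use finV in \<open>auto simp: S_def\<close>)
      \<comment> \<open>The cone with apex \<open>x\<close> over the part of \<open>z\<close> on
        \<open>S\<close>, with the sign chosen so that its boundary has the same coefficients on
        \<open>S\<close> as \<open>z\<close>.\<close>
      define W where "W \<tau> = (if x \<in> \<tau> \<and> \<tau> - {x} \<in> S
        then face_sign r \<tau> x * Poly_Mapping.lookup z (\<tau> - {x}) else 0)" for \<tau>
      have "{\<tau>. W \<tau> \<noteq> 0} \<subseteq> insert x ` S"
        by (auto simp: W_def image_iff split: if_splits intro!: bexI[of _ "_ - {x}"])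
      then have "finite {\<tau>. W \<tau> \<noteq> 0}"
        using \<open>finite S\<close> finite_subset by blast
      then have lookup_W: "Poly_Mapping.lookup (Abs_poly_mapping W) = W"
        by simp
      define w where "w = Abs_poly_mapping W"
      have w: "Poly_Mapping.lookup w = W"
        by (simp add: w_def lookup_W)
      have keys_w: "Poly_Mapping.keys w \<subseteq> faces r Q (i + 1)"
      proof
        fix \<tau> assume "\<tau> \<in> Poly_Mapping.keys w"
        then have \<tau>: "x \<in> \<tau>" "\<tau> - {x} \<in> S" "\<tau> - {x} \<in> Poly_Mapping.keys z"
          by (auto simp: in_keys_iff w W_def split: if_splits)
        then have "\<tau> \<subseteq> V f"
          using x by (auto simp: S_def)
        then have "\<tau> \<in> order_complex r Q" "finite \<tau>"
          using complex f Suc.prems(1) finV finite_subset by auto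
        moreover have "int (card \<tau>) = i + 1 + 1"
          using card_face[OF \<tau>(3)] card_Suc_Diff1[OF \<open>finite \<tau>\<close> \<tau>(1)] by linarith
        ultimately show "\<tau> \<in> faces r Q (i + 1)"
          by (simp add: faces_def)
      qed
      then have wP: "Poly_Mapping.keys w \<subseteq> Pow Q"
        using faces_subset_Pow by blast
      define y where "y = z - boundary_map r w"
      have bw: "Poly_Mapping.keys (boundary_map r w) \<subseteq> faces r Q i"
        using keys_boundary_map[OF Q keys_w] by simp
      have keys_y: "Poly_Mapping.keys y \<subseteq> faces r Q i"
        using keys_diff[of z "boundary_map r w"] bw Suc.prems(3) by (auto simp: y_def)
      have yP: "Poly_Mapping.keys y \<subseteq> Pow Q"
        using keys_y faces_subset_Pow by blast
      have bP: "Poly_Mapping.keys (boundary_map r w) \<subseteq> Pow Q"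
        using bw faces_subset_Pow by blast
      have dy: "boundary_map r y = 0"
        using boundary_map_boundary_map[OF Q r keys_w] Suc.prems(5) bP
        by (simp add: y_def boundary_map_diff[OF Q zP bP])
      have yS: "Poly_Mapping.lookup y \<sigma> = 0" if \<sigma>: "\<sigma> \<in> S" for \<sigma>
      proof -
        have "Poly_Mapping.lookup (boundary_map r w) \<sigma> =
            (\<Sum>v\<in>Q - \<sigma>. face_sign r (insert v \<sigma>) v * W (insert v \<sigma>))"
          by (simp add: lookup_boundary_map[OF Q wP] w)
        also have "\<dots> = (\<Sum>v\<in>{x}. face_sign r (insert v \<sigma>) v * W (insert v \<sigma>))"
          using Q \<sigma> x VQ by (intro sum.mono_neutral_right) (auto simp: W_def S_def)
        also have "\<dots> = Poly_Mapping.lookup z \<sigma>"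
          using \<sigma> by (simp add: W_def S_def mult.assoc[symmetric])
        finally show ?thesis
          by (simp add: y_def lookup_minus)
      qed
      have y_faces: "\<sigma> \<in> ?\<Delta> I" if "\<sigma> \<in> Poly_Mapping.keys y" for \<sigma>
      proof -
        have "\<sigma> \<in> Poly_Mapping.keys z \<or> \<sigma> \<in> Poly_Mapping.keys (boundary_map r w)"
          using that keys_diff[of z "boundary_map r w"] by (auto simp: y_def)
        then show ?thesis
        proof
          assume "\<sigma> \<in> Poly_Mapping.keys (boundary_map r w)"
          then have "(\<Sum>v\<in>Q - \<sigma>. face_sign r (insert v \<sigma>) v * W (insert v \<sigma>)) \<noteq> 0"
            by (simp add: in_keys_iff lookup_boundary_map[OF Q wP] w)
          then obtain v where "face_sign r (insert v \<sigma>) v * W (insert v \<sigma>) \<noteq> 0"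
            by (rule sum.not_neutral_contains_not_neutral)
          then have "W (insert v \<sigma>) \<noteq> 0"
            by simp
          then have "insert v \<sigma> \<subseteq> V f"
            using x by (auto simp: W_def S_def split: if_splits)
          then show ?thesis
            using f by auto
        qed (use Suc.prems in auto)
      qed
      have "Poly_Mapping.keys y \<subseteq> ?\<Delta> ?I"
      proof
        fix \<tau> assume \<tau>: "\<tau> \<in> Poly_Mapping.keys y"
        show "\<tau> \<in> ?\<Delta> ?I"
        proof (rule ccontr)
          assume *: "\<tau> \<notin> ?\<Delta> ?I"
          have \<tau>f: "\<tau> \<subseteq> V f"
            using y_faces[OF \<tau>] * by auto
          have R\<tau>: "?R \<subseteq> \<tau>"
            using new[OF \<tau>f] * by blast
          have x\<tau>: "x \<in> \<tau>"
            using yS[of \<tau>] \<tau> \<tau>f R\<tau> by (auto simp: S_def in_keys_iff)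
          let ?\<sigma> = "\<tau> - {x}"
          have \<sigma>: "?\<sigma> \<subseteq> V f" "?R \<subseteq> ?\<sigma>"
            using \<tau>f R\<tau> x by auto
          \<comment> \<open>The larger members of the pairs now vanish without further work: in the
            cycle equation at the smaller face, every other face that could contribute lies in
            \<open>S\<close>, where \<open>y\<close> is already zero.\<close>
          have "0 = Poly_Mapping.lookup (boundary_map r y) ?\<sigma>"
            by (simp add: dy)
          also have "\<dots> = (\<Sum>v\<in>Q - ?\<sigma>. face_sign r (insert v ?\<sigma>) v * Poly_Mapping.lookup y (insert v ?\<sigma>))"
            by (rule lookup_boundary_map[OF Q yP])
          also have "\<dots> = (\<Sum>v\<in>{x}. face_sign r (insert v ?\<sigma>) v * Poly_Mapping.lookup y (insert v ?\<sigma>))"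
          proof (intro sum.mono_neutral_right ballI)
            fix v assume v: "v \<in> Q - ?\<sigma> - {x}"
            have "Poly_Mapping.lookup y (insert v ?\<sigma>) = 0"
            proof (rule ccontr)
              assume "Poly_Mapping.lookup y (insert v ?\<sigma>) \<noteq> 0"
              then have k: "insert v ?\<sigma> \<in> Poly_Mapping.keys y"
                by (simp add: in_keys_iff)
              have "insert v ?\<sigma> \<notin> ?\<Delta> ?I"
                using new[OF \<sigma>(1)] \<sigma>(2) by auto
              then have "insert v ?\<sigma> \<subseteq> V f"
                using y_faces[OF k] by auto
              then have "insert v ?\<sigma> \<in> S"
                using \<sigma> v by (auto simp: S_def)
              then show False
                using yS k by (auto simp: in_keys_iff)
            qed
            then show "face_sign r (insert v ?\<sigma>) v * Poly_Mapping.lookup y (insert v ?\<sigma>) = 0"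
              by simp
          qed (use Q x VQ in auto)
          also have "\<dots> = face_sign r \<tau> x * Poly_Mapping.lookup y \<tau>"
            using x\<tau> by (simp add: insert_absorb)
          finally have "Poly_Mapping.lookup y \<tau> = 0"
            by (metis face_sign_mult_eq_0_iff)
          then show False
            using \<tau> by (simp add: in_keys_iff)
        qed
      qed
      then obtain w' where w': "Poly_Mapping.keys w' \<subseteq> faces r Q (i + 1)" "boundary_map r w' = y"
        using IH keys_y dy by blast
      then have w'P: "Poly_Mapping.keys w' \<subseteq> Pow Q"
        using faces_subset_Pow by blast
      have "boundary_map r (w + w') = z"
        using w' by (simp add: boundary_map_add[OF Q wP w'P] y_def)
      moreover have "Poly_Mapping.keys (w + w') \<subseteq> faces r Q (i + 1)"
        using keys_add[of w w'] keys_w w' by blast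
      ultimately show ?thesis by blast
    qed
  qed
  from this[of J z] show ?thesis
    using z complex by (auto simp: faces_def)
qed

section \<open>Edge labellings\<close>

text \<open>The number with digits \<open>a 0, ..., a (k - 1)\<close> in base \<open>N\<close>,
  leading digit first. It turns lexicographic comparison of label sequences into comparison of
  natural numbers, as the order of the facets is given by a map to \<open>nat\<close>.\<close>

primrec radix_weight :: "nat \<Rightarrow> (nat \<Rightarrow> nat) \<Rightarrow> nat \<Rightarrow> nat" where
  "radix_weight N a 0 = 0"
| "radix_weight N a (Suc k) = N * radix_weight N a k + a k"

lemma radix_weight_cong: "(\<And>i. i < k \<Longrightarrow> a i = b i) \<Longrightarrow> radix_weight N a k = radix_weight N b k"
  by (induction k) auto

lemma radix_weight_less:
  assumes "m < k" "\<And>i. i < m \<Longrightarrow> a i = b i" "a m < b m" "\<And>i. i < k \<Longrightarrow> a i < N"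
  shows "radix_weight N a k < radix_weight N b k"
  using assms
proof (induction k)
  case (Suc k)
  show ?case
  proof (cases "m = k")
    case True
    then have "radix_weight N a k = radix_weight N b k"
      using Suc.prems(2) by (intro radix_weight_cong) auto
    then show ?thesis
      using True Suc.prems(3) by simp
  next
    case False
    then have "Suc (radix_weight N a k) \<le> radix_weight N b k"
      using Suc by auto
    then have "N * Suc (radix_weight N a k) \<le> N * radix_weight N b k"
      by (rule mult_le_mono2)
    moreover have "a k < N"
      using Suc.prems(4) by simp
    ultimately show ?thesis by simp
  qed
qed simp

text \<open>
  The axioms of an EL-labelling with the two requirements on ascents decoupled: \<open>ascent\<close> need not
  be the comparison of consecutive labels, and lexicographic minimality is only required in
  intervals of length 2.
\<close>

locale lexicographic_covers =
  fixes P :: "'a set" and cover :: "'a \<Rightarrow> 'a \<Rightarrow> bool" and rank :: "'a \<Rightarrow> int"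
    and label :: "'a \<Rightarrow> 'a \<Rightarrow> nat" and ascent :: "'a \<Rightarrow> 'a \<Rightarrow> 'a \<Rightarrow> bool"
  assumes finite_P: "finite P"
    and cover_in: "cover x y \<Longrightarrow> x \<in> P \<and> y \<in> P"
    and rank_cover: "cover x y \<Longrightarrow> rank y = rank x + 1"
    and descent: "cover x y \<Longrightarrow> cover y z \<Longrightarrow> \<not> ascent x y z \<Longrightarrow>
      \<exists>y'. cover x y' \<and> cover y' z \<and> label x y' < label x y"
    and ascending_unique: "0 < k \<Longrightarrow> f 0 = g 0 \<Longrightarrow> f k = g k \<Longrightarrow>
      (\<And>i. i < k \<Longrightarrow> cover (f i) (f (Suc i))) \<Longrightarrow>
      (\<And>i. i < k \<Longrightarrow> cover (g i) (g (Suc i))) \<Longrightarrow>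
      (\<And>i. Suc i < k \<Longrightarrow> ascent (f i) (f (Suc i)) (f (Suc (Suc i)))) \<Longrightarrow>
      (\<And>i. Suc i < k \<Longrightarrow> ascent (g i) (g (Suc i)) (g (Suc (Suc i)))) \<Longrightarrow>
      f (Suc 0) = g (Suc 0)"
begin

definition ord :: "'a rel" where
  "ord = {(x, y). x \<in> P \<and> y \<in> P \<and> cover\<^sup>*\<^sup>* x y}"

definition len :: "'a \<Rightarrow> 'a \<Rightarrow> nat" where
  "len x y = nat (rank y - rank x)"

text \<open>Being extensional beyond \<open>len x y\<close>, these functions form a finite set, and
  equal values up to \<open>len x y\<close> make them equal.\<close>

definition saturated :: "'a \<Rightarrow> 'a \<Rightarrow> (nat \<Rightarrow> 'a) set" where
  "saturated x y = {f \<in> {..len x y} \<rightarrow>\<^sub>E P.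
     f 0 = x \<and> f (len x y) = y \<and> (\<forall>i<len x y. cover (f i) (f (Suc i)))}"

definition inner :: "'a \<Rightarrow> 'a \<Rightarrow> (nat \<Rightarrow> 'a) \<Rightarrow> 'a set" where
  "inner x y f = f ` {0<..<len x y}"

text \<open>Compares label sequences lexicographically.\<close>

definition chain_weight :: "'a \<Rightarrow> 'a \<Rightarrow> (nat \<Rightarrow> 'a) \<Rightarrow> nat" where
  "chain_weight x y f = radix_weight (Suc (Max (case_prod label ` (P \<times> P))))
     (\<lambda>i. label (f i) (f (Suc i))) (len x y)"

section \<open>Ranks and saturated chains\<close>

lemma label_bound: "x \<in> P \<Longrightarrow> y \<in> P \<Longrightarrow> label x y < Suc (Max (case_prod label ` (P \<times> P)))"
  using finite_P by (intro le_imp_less_Suc Max_ge) auto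

lemma rank_rtranclp: "cover\<^sup>*\<^sup>* x y \<Longrightarrow> x = y \<or> rank x < rank y"
  by (induction rule: rtranclp_induct) (auto dest: rank_cover)

lemma rank_mono: "(x, y) \<in> ord \<Longrightarrow> rank x \<le> rank y"
  and ord_eqI: "(x, y) \<in> ord \<Longrightarrow> rank y \<le> rank x \<Longrightarrow> x = y"
  by (auto simp: ord_def dest: rank_rtranclp)

lemma antisym_ord: "antisym ord"
  by (rule antisymI) (auto intro: ord_eqI rank_mono)

lemma ord_trans: "(x, y) \<in> ord \<Longrightarrow> (y, z) \<in> ord \<Longrightarrow> (x, z) \<in> ord"
  by (auto simp: ord_def)

lemma rank_saturated: "f \<in> saturated x y \<Longrightarrow> i \<le> len x y \<Longrightarrow> rank (f i) = rank x + int i"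
proof (induction i)
  case (Suc i)
  then show ?case
    using rank_cover[of "f i" "f (Suc i)"] by (auto simp: saturated_def)
qed (simp add: saturated_def)

lemma ord_saturated:
  assumes f: "f \<in> saturated x y" and "i \<le> j" "j \<le> len x y"
  shows "(f i, f j) \<in> ord"
  using assms(2,3)
proof (induction j rule: dec_induct)
  case base
  then show ?case
    using f by (auto simp: ord_def saturated_def)
next
  case (step j)
  then have "cover (f j) (f (Suc j))"
    using f by (auto simp: saturated_def)
  then show ?case
    using step by (auto simp: ord_def dest: cover_in)
qed

text \<open>The position of an element in a saturated chain is recovered from its rank, so two
  chains between the same ends can share an element only at the same position.\<close>

lemma inner_eq:
  assumes "f \<in> saturated x y" "g \<in> saturated x y" "i \<le> len x y" "f i \<in> inner x y g"
  shows "f i = g i"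
proof -
  obtain j where j: "0 < j" "j < len x y" "f i = g j"
    using assms by (auto simp: inner_def)
  then have "i = j"
    using rank_saturated[OF assms(1), of i] rank_saturated[OF assms(2), of j] assms(3) by auto
  then show ?thesis
    using j by simp
qed

lemma card_inner:
  assumes "f \<in> saturated x y"
  shows "card (inner x y f) = len x y - 1"
proof -
  have "inj_on f {0<..<len x y}"
  proof (rule inj_onI)
    fix i j assume ij: "i \<in> {0<..<len x y}" "j \<in> {0<..<len x y}" and eq: "f i = f j"
    have "rank x + int i = rank x + int j"
      using rank_saturated[OF assms, of i] rank_saturated[OF assms, of j] ij unfolding eq by auto
    then show "i = j"
      by simp
  qed
  then show ?thesis
    by (simp add: inner_def card_image)
qed

lemma finite_saturated: "finite (saturated x y)"
  by (rule finite_subset[of _ "{..len x y} \<rightarrow>\<^sub>E P"])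
    (auto simp: saturated_def intro!: finite_PiE finite_P)

text \<open>Induction on the length: the first step goes to a cover of \<open>x\<close> that lies
  below the least element of the chain other than \<open>x\<close>. This yields both the facets of
  open intervals and the bound on the length of closed ones.\<close>

lemma chain_extends_to_path:
  assumes "(x, y) \<in> ord" "finite \<sigma>" "\<sigma> \<in> Chains ord" "\<And>s. s \<in> \<sigma> \<Longrightarrow> (x, s) \<in> ord \<and> (s, y) \<in> ord"
  shows "\<exists>f. f 0 = x \<and> f (len x y) = y \<and> (\<forall>i<len x y. cover (f i) (f (Suc i))) \<and> \<sigma> \<subseteq> f ` {..len x y}"
  using assms
proof (induction "len x y" arbitrary: x \<sigma>)
  case 0
  then have "x = y"
    by (intro ord_eqI) (auto simp: len_def)
  then have "\<sigma> \<subseteq> {x}"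
    using 0 antisym_ord by (auto dest: antisymD)
  then show ?case
    using \<open>x = y\<close> by (intro exI[of _ "\<lambda>_. x"]) (auto simp: len_def)
next
  case (Suc k)
  \<comment> \<open>Inserting \<open>y\<close> guarantees a least element even if nothing of
    \<sigma> is left above \<open>x\<close>.\<close>
  define T where "T = insert y (\<sigma> - {x})"
  have T: "finite T" "T \<noteq> {}"
    using Suc.prems by (auto simp: T_def)
  have yy: "(y, y) \<in> ord"
    using Suc.prems(1) by (auto simp: ord_def)
  have chain: "(s, t) \<in> ord \<or> (t, s) \<in> ord" if "s \<in> T" "t \<in> T" for s t
    using that Suc.prems(3,4) yy by (auto simp: T_def Chains_def)
  have "Min (rank ` T) \<in> rank ` T"
    using T by (intro Min_in) auto
  then obtain s where s: "s \<in> T" and "Min (rank ` T) = rank s"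
    by blast
  then have "rank s \<le> rank t" if "t \<in> T" for t
    using that T Min_le[of "rank ` T" "rank t"] by simp
  then have least: "(s, t) \<in> ord" if "t \<in> T" for t
    using chain[OF s that] that ord_eqI[of t s] by auto
  have "x \<noteq> y"
    using Suc.hyps(2) by (auto simp: len_def)
  then have "x \<noteq> s" "(x, s) \<in> ord"
    using s Suc.prems by (auto simp: T_def)
  then obtain x' where x': "cover x x'" "cover\<^sup>*\<^sup>* x' s"
    by (auto simp: ord_def elim: converse_rtranclpE)
  then have x's: "(x', s) \<in> ord"
    using \<open>(x, s) \<in> ord\<close> cover_in by (auto simp: ord_def)
  have ge: "(x', t) \<in> ord" if "t \<in> T" for t
    using ord_trans[OF x's least[OF that]] .
  have k: "k = len x' y"
    using Suc.hyps(2) rank_cover[OF x'(1)] by (simp add: len_def)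
  have "\<exists>f. f 0 = x' \<and> f (len x' y) = y \<and> (\<forall>i<len x' y. cover (f i) (f (Suc i))) \<and>
      \<sigma> - {x} \<subseteq> f ` {..len x' y}"
  proof (rule Suc.hyps(1)[OF k])
    show "(x', y) \<in> ord"
      by (rule ge) (simp add: T_def)
    show "\<sigma> - {x} \<in> Chains ord"
      using Suc.prems(3) by (auto simp: Chains_def)
    show "(x', s) \<in> ord \<and> (s, y) \<in> ord" if "s \<in> \<sigma> - {x}" for s
      using ge[of s] that Suc.prems(4)[of s] by (auto simp: T_def)
  qed (use Suc.prems in auto)
  then obtain f where f: "f 0 = x'" "f k = y" "\<forall>i<k. cover (f i) (f (Suc i))" "\<sigma> - {x} \<subseteq> f ` {..k}"
    by (auto simp: k)
  let ?g = "case_nat x f"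
  have "\<forall>i<Suc k. cover (?g i) (?g (Suc i))"
    using f x' by (auto split: nat.split)
  moreover have "\<sigma> \<subseteq> ?g ` {..Suc k}"
  proof
    fix t assume "t \<in> \<sigma>"
    show "t \<in> ?g ` {..Suc k}"
    proof (cases "t = x")
      case False
      then obtain i where "i \<le> k" "t = f i"
        using f(4) \<open>t \<in> \<sigma>\<close> by auto
      then show ?thesis
        by (intro image_eqI[of _ _ "Suc i"]) auto
    qed (auto intro: image_eqI[of _ _ 0])
  qed
  ultimately show ?case
    unfolding Suc.hyps(2)[symmetric] using f by (intro exI[of _ ?g]) auto
qed

lemma order_complex_open_interval:
  assumes xy: "(x, y) \<in> ord"
  shows "order_complex ord (open_interval ord x y) = {\<sigma>. \<exists>f\<in>saturated x y. \<sigma> \<subseteq> inner x y f}"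
proof (intro subset_antisym subsetI)
  fix \<sigma> assume \<sigma>: "\<sigma> \<in> order_complex ord (open_interval ord x y)"
  then have between: "(x, s) \<in> ord \<and> (s, y) \<in> ord \<and> s \<noteq> x \<and> s \<noteq> y" if "s \<in> \<sigma>" for s
    using that by (auto simp: order_complex_def open_interval_def aboveS_def underS_def)
  obtain f where f: "f 0 = x" "f (len x y) = y" "\<forall>i<len x y. cover (f i) (f (Suc i))" "\<sigma> \<subseteq> f ` {..len x y}"
    using chain_extends_to_path[OF xy, of \<sigma>] \<sigma> between by (auto simp: order_complex_def)
  have in_P: "f i \<in> P" if "i \<le> len x y" for i
  proof (cases i)
    case (Suc j)
    then show ?thesis
      using that f(3) cover_in[of "f j" "f (Suc j)"] by auto
  qed (use f xy in \<open>simp add: ord_def\<close>)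
  let ?f = "restrict f {..len x y}"
  have "?f \<in> saturated x y"
    using f in_P by (auto simp: saturated_def)
  moreover have "\<sigma> \<subseteq> inner x y ?f"
  proof
    fix s assume "s \<in> \<sigma>"
    then obtain i where i: "i \<le> len x y" "s = f i"
      using f by auto
    then have "i \<noteq> 0" "i \<noteq> len x y"
      using between[OF \<open>s \<in> \<sigma>\<close>] f(1,2) by (intro notI; simp)+
    then show "s \<in> inner x y ?f"
      using i by (auto simp: inner_def)
  qed
  ultimately show "\<sigma> \<in> {\<sigma>. \<exists>f\<in>saturated x y. \<sigma> \<subseteq> inner x y f}" by blast
next
  fix \<sigma> assume "\<sigma> \<in> {\<sigma>. \<exists>f\<in>saturated x y. \<sigma> \<subseteq> inner x y f}"
  then obtain f where f: "f \<in> saturated x y" and \<sigma>: "\<sigma> \<subseteq> inner x y f"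
    by blast
  have "inner x y f \<in> Chains ord"
  proof (clarsimp simp: inner_def Chains_def)
    fix i j assume "0 < i" "i < len x y" "0 < j" "j < len x y" "(f j, f i) \<notin> ord"
    then show "(f i, f j) \<in> ord"
      using ord_saturated[OF f, of i j] ord_saturated[OF f, of j i] by linarith
  qed
  moreover have "inner x y f \<subseteq> open_interval ord x y"
  proof
    fix s assume "s \<in> inner x y f"
    then obtain i where i: "0 < i" "i < len x y" "s = f i"
      by (auto simp: inner_def)
    have "f 0 = x" "f (len x y) = y"
      using f by (auto simp: saturated_def)
    then show "s \<in> open_interval ord x y"
      using i ord_saturated[OF f, of 0 i] ord_saturated[OF f, of i "len x y"]
        rank_saturated[OF f, of i] rank_saturated[OF f, of "len x y"]
      by (auto simp: open_interval_def aboveS_def underS_def)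
  qed
  moreover have "finite (inner x y f)"
    by (simp add: inner_def)
  ultimately have "inner x y f \<in> order_complex ord (open_interval ord x y)"
    by (simp add: order_complex_def)
  then show "\<sigma> \<in> order_complex ord (open_interval ord x y)"
    using \<sigma> by (rule order_complex_mono)
qed

text \<open>The new chain is earlier and misses at most the replaced element, which is precisely
  what puts every descent of \<open>f\<close> into its restriction set.\<close>

lemma descent_improves:
  assumes f: "f \<in> saturated x y" and i: "Suc i < len x y"
    and desc: "\<not> ascent (f i) (f (Suc i)) (f (Suc (Suc i)))"
  shows "\<exists>g\<in>saturated x y. chain_weight x y g < chain_weight x y f \<and>
    inner x y f - {f (Suc i)} \<subseteq> inner x y g"
proof -
  have "cover (f i) (f (Suc i))" "cover (f (Suc i)) (f (Suc (Suc i)))"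
    using f i by (auto simp: saturated_def)
  from descent[OF this desc] obtain z where
    z: "cover (f i) z" "cover z (f (Suc (Suc i)))" "label (f i) z < label (f i) (f (Suc i))"
    by blast
  let ?g = "f(Suc i := z)"
  have g: "?g \<in> saturated x y"
    using f i z cover_in[OF z(1)]
    by (auto simp: saturated_def PiE_iff extensional_def less_Suc_eq_le)
  have "chain_weight x y ?g < chain_weight x y f"
    unfolding chain_weight_def
  \<comment> \<open>Only the labels at positions \<open>i\<close> and \<open>Suc i\<close> change.
    The first one drops, so an increase of the second one does not matter.\<close>
  proof (rule radix_weight_less[where m = i])
    show "label (?g j) (?g (Suc j)) < Suc (Max (case_prod label ` (P \<times> P)))" if "j < len x y" for j
      using g that by (intro label_bound) (auto simp: saturated_def PiE_iff simp del: fun_upd_apply)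
  qed (use i z in auto)
  moreover have "inner x y f - {f (Suc i)} \<subseteq> inner x y ?g"
    by (auto simp: inner_def)
  ultimately show ?thesis
    using g by blast
qed

text \<open>Every descent of either chain is a common element. Hence between two consecutive common
  elements both chains ascend, and \<open>ascending_unique\<close> leaves no room for a
  difference.\<close>

lemma saturated_unique:
  assumes f: "f \<in> saturated x y" and g: "g \<in> saturated x y"
    and df: "\<And>i. Suc i < len x y \<Longrightarrow> \<not> ascent (f i) (f (Suc i)) (f (Suc (Suc i))) \<Longrightarrow> f (Suc i) \<in> inner x y g"
    and dg: "\<And>i. Suc i < len x y \<Longrightarrow> \<not> ascent (g i) (g (Suc i)) (g (Suc (Suc i))) \<Longrightarrow> g (Suc i) \<in> inner x y f"
  shows "f = g"
proof -
  have "f i = g i" if "i \<le> len x y" for i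
    using that
  proof (induction i)
    case 0
    then show ?case
      using f g by (simp add: saturated_def)
  next
    case (Suc i)
    \<comment> \<open>The distance from position \<open>i\<close> to the next common element; the
      common endpoint \<open>y\<close> shows that there is one.\<close>
    define k where "k = (LEAST k. 0 < k \<and> f (i + k) = g (i + k) \<and> i + k \<le> len x y)"
    have "0 < len x y - i \<and> f (i + (len x y - i)) = g (i + (len x y - i)) \<and> i + (len x y - i) \<le> len x y"
      using f g Suc.prems by (simp add: saturated_def)
    then have k: "0 < k" "f (i + k) = g (i + k)" "i + k \<le> len x y"
      unfolding k_def by (metis (mono_tags, lifting) LeastI)+
    have less: "f (i + j) \<noteq> g (i + j)" if "0 < j" "j < k" for j
      using not_less_Least[of j "\<lambda>k. 0 < k \<and> f (i + k) = g (i + k) \<and> i + k \<le> len x y"] that k(3)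
      by (auto simp: k_def[symmetric])
    have "f (i + Suc 0) = g (i + Suc 0)"
    proof (rule ascending_unique[of k "\<lambda>j. f (i + j)" "\<lambda>j. g (i + j)"])
      show "f (i + 0) = g (i + 0)"
        using Suc by simp
      show "cover (f (i + j)) (f (i + Suc j))" "cover (g (i + j)) (g (i + Suc j))" if "j < k" for j
        using f g that k(3) by (auto simp: saturated_def)
      fix j assume j: "Suc j < k"
      then have "Suc (i + j) < len x y" and "f (Suc (i + j)) \<noteq> g (Suc (i + j))"
        using less[of "Suc j"] k(3) by auto
      then show "ascent (f (i + j)) (f (i + Suc j)) (f (i + Suc (Suc j)))"
        "ascent (g (i + j)) (g (i + Suc j)) (g (i + Suc (Suc j)))"
        using df[of "i + j"] dg[of "i + j"] inner_eq[OF f g, of "Suc (i + j)"]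
          inner_eq[OF g f, of "Suc (i + j)"] unfolding add_Suc_right
        by (metis less_imp_le)+
    qed (use k in auto)
    then show ?case by simp
  qed
  moreover have "f i = g i" if "\<not> i \<le> len x y" for i
    using f g that by (auto simp: saturated_def PiE_iff extensional_def)
  ultimately show ?thesis by blast
qed

text \<open>Suppose \<open>g\<close> contains the restriction set \<open>?R\<close> of
  \<open>f\<close>. A chain of least weight among those containing \<open>?R\<close> has all its
  descents in \<open>?R\<close>, since repairing another descent would keep \<open>?R\<close> and
  lower the weight. The descents of \<open>f\<close> lie in \<open>?R\<close> too, so this chain is
  \<open>f\<close> by \<open>saturated_unique\<close>. As \<open>g\<close> is not heavier, it is of
  least weight as well and equals \<open>f\<close>.\<close>

lemma lexicographic_shelling:
  assumes f: "f \<in> saturated x y" and g: "g \<in> saturated x y" and "f \<noteq> g"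
    and gf: "chain_weight x y g \<le> chain_weight x y f"
  shows "\<exists>v\<in>shelling_restriction (saturated x y) (inner x y) (chain_weight x y) f. v \<notin> inner x y g"
proof (rule ccontr)
  let ?R = "shelling_restriction (saturated x y) (inner x y) (chain_weight x y) f"
  let ?A = "{h \<in> saturated x y. ?R \<subseteq> inner x y h}"
  assume "\<not> ?thesis"
  then have gA: "g \<in> ?A"
    using g by blast
  have R: "?R \<subseteq> inner x y f"
    by (auto simp: shelling_restriction_def)
  have f_desc: "f (Suc i) \<in> ?R"
    if "Suc i < len x y" "\<not> ascent (f i) (f (Suc i)) (f (Suc (Suc i)))" for i
    using descent_improves[OF f that] that(1) by (auto simp: shelling_restriction_def inner_def)
  have least_eq: "h = f"
    if h: "h \<in> ?A" and h_min: "\<And>h'. h' \<in> ?A \<Longrightarrow> chain_weight x y h \<le> chain_weight x y h'" for h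
  proof (rule saturated_unique)
    show hs: "h \<in> saturated x y"
      using h by blast
    show "h (Suc i) \<in> inner x y f"
      if i: "Suc i < len x y" "\<not> ascent (h i) (h (Suc i)) (h (Suc (Suc i)))" for i
    proof -
      obtain h' where h': "h' \<in> saturated x y" "chain_weight x y h' < chain_weight x y h"
        "inner x y h - {h (Suc i)} \<subseteq> inner x y h'"
        using descent_improves[OF hs i] by blast
      then have "h' \<notin> ?A"
        using h_min[of h'] by auto
      then have "\<not> ?R \<subseteq> inner x y h'"
        using h'(1) by simp
      moreover have "?R \<subseteq> inner x y h"
        using h by simp
      ultimately have "h (Suc i) \<in> ?R"
        using h'(3) by blast
      then show ?thesis
        using R by blast
    qed
    show "f (Suc i) \<in> inner x y h"
      if "Suc i < len x y" "\<not> ascent (f i) (f (Suc i)) (f (Suc (Suc i)))" for i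
      using f_desc[OF that] h by blast
  qed (rule f)
  define h where "h = arg_min (chain_weight x y) (\<lambda>h. h \<in> ?A)"
  have hA: "h \<in> ?A" and h_min: "\<And>h'. h' \<in> ?A \<Longrightarrow> chain_weight x y h \<le> chain_weight x y h'"
    unfolding h_def using arg_min_nat_lemma[of "\<lambda>h. h \<in> ?A" g "chain_weight x y"] gA by auto
  have "h = f"
    by (rule least_eq[OF hA h_min])
  have "g = f"
  proof (rule least_eq[OF gA])
    show "chain_weight x y g \<le> chain_weight x y h'" if "h' \<in> ?A" for h'
      using gf h_min[OF that] \<open>h = f\<close> by simp
  qed
  then show False
    using \<open>f \<noteq> g\<close> by simp
qed

section \<open>Homology of intervals\<close>

lemma finite_open_interval: "finite (open_interval ord x y)"
  and finite_closed_interval: "finite (closed_interval ord x y)"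
  by (auto intro!: finite_subset[OF _ finite_P]
      simp: open_interval_def closed_interval_def aboveS_def above_def ord_def)

text \<open>An upper bound suffices: replacing the length by \<open>len x y\<close> can only enlarge
  the range of degrees in which homology has to vanish.\<close>

lemma poset_length_closed_interval:
  assumes xy: "(x, y) \<in> ord"
  shows "poset_length ord (closed_interval ord x y) \<le> int (len x y)"
proof -
  let ?C = "order_complex ord (closed_interval ord x y)"
  have "finite ?C"
    by (rule finite_subset[of _ "Pow (closed_interval ord x y)"])
      (auto simp: order_complex_def finite_closed_interval)
  moreover have "{} \<in> ?C"
    by (simp add: order_complex_def Chains_def)
  moreover have "card \<sigma> \<le> Suc (len x y)" if "\<sigma> \<in> ?C" for \<sigma>
  proof -
    have "finite \<sigma>" "\<sigma> \<in> Chains ord" "\<And>s. s \<in> \<sigma> \<Longrightarrow> (x, s) \<in> ord \<and> (s, y) \<in> ord"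
      using that by (auto simp: order_complex_def closed_interval_def above_def under_def)
    from chain_extends_to_path[OF xy this] obtain f where "\<sigma> \<subseteq> f ` {..len x y}"
      by auto
    then have "card \<sigma> \<le> card (f ` {..len x y})"
      by (intro card_mono) auto
    also have "\<dots> \<le> Suc (len x y)"
      using card_image_le[of "{..len x y}" f] by simp
    finally show ?thesis .
  qed
  ultimately have "Max (card ` ?C) \<le> Suc (len x y)"
    by (subst Max_le_iff) auto
  then show ?thesis
    by (simp add: poset_length_def)
qed

theorem Cohen_Macaulay_ord: "Cohen_Macaulay TYPE('k::comm_ring_1) ord"
  unfolding Cohen_Macaulay_def
proof (intro allI impI; elim conjE)
  fix x y i assume xy: "(x, y) \<in> ord" "x \<noteq> y"
    and i: "i < poset_length ord (closed_interval ord x y) - 2"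
  \<comment> \<open>Facets of the open interval have \<open>len x y - 1\<close> vertices, so
    \<open>i\<close> is strictly below their dimension.\<close>
  have "i + 1 < int (len x y) - 1"
    using i poset_length_closed_interval[OF xy(1)] by simp
  then show "trivial_group (reduced_poset_homology ord (open_interval ord x y) i :: ('a set \<Rightarrow>\<^sub>0 'k) set monoid)"
    by (intro trivial_reduced_poset_homology finite_open_interval antisym_ord
        shellable_cycle_is_boundary[OF finite_open_interval antisym_ord finite_saturated
          order_complex_open_interval[OF xy(1)], where \<mu> = "chain_weight x y"]
        lexicographic_shelling) (simp_all add: card_inner)
qed

end

section \<open>Merging blocks of weighted partitions\<close>

type_synonym wpartition = "(nat set \<times> nat) set"

text \<open>Injectivity of \<open>fst\<close> is absorbed by disjointness: two different weights on
  one block would make a nonempty block disjoint from itself. Nonempty blocks also turn the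
  truncated subtraction into a strict bound.\<close>

lemma weighted_partitions_iff:
  "\<alpha> \<in> weighted_partitions n \<longleftrightarrow>
     (\<forall>p\<in>\<alpha>. fst p \<noteq> {} \<and> snd p < card (fst p)) \<and> \<Union>(fst ` \<alpha>) = {1..n} \<and>
     (\<forall>p\<in>\<alpha>. \<forall>q\<in>\<alpha>. p \<noteq> q \<longrightarrow> fst p \<inter> fst q = {})"
  (is "?L \<longleftrightarrow> ?R")
proof
  assume L: ?L
  then have part: "partition_on {1..n} (fst ` \<alpha>)" and inj: "inj_on fst \<alpha>"
    and w: "\<And>p. p \<in> \<alpha> \<Longrightarrow> snd p \<le> card (fst p) - 1"
    by (auto simp: weighted_partitions_def)
  have ne: "fst p \<noteq> {}" "finite (fst p)" if "p \<in> \<alpha>" for p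
  proof -
    have "fst p \<subseteq> {1..n}"
      using part that unfolding partition_on_def by blast
    then show "finite (fst p)"
      by (rule finite_subset) simp
    show "fst p \<noteq> {}"
      using part that unfolding partition_on_def by (metis image_eqI)
  qed
  then have "0 < card (fst p)" if "p \<in> \<alpha>" for p
    using that by (simp add: card_gt_0_iff)
  then have "snd p < card (fst p)" if "p \<in> \<alpha>" for p
    using w[OF that] that by fastforce
  moreover have "fst p \<inter> fst q = {}" if "p \<in> \<alpha>" "q \<in> \<alpha>" "p \<noteq> q" for p q
    using part inj that unfolding partition_on_def disjoint_def by (metis image_eqI inj_onD)
  ultimately show ?R
    using part ne by (auto simp: partition_on_def)
next
  assume R: ?R
  then have "inj_on fst \<alpha>"
    by (intro inj_onI) (metis inf.idem)
  moreover have "partition_on {1..n} (fst ` \<alpha>)"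
    unfolding partition_on_def
  proof (intro conjI)
    show "disjoint (fst ` \<alpha>)"
      unfolding disjoint_def
    proof (clarify)
      fix p q assume "p \<in> \<alpha>" "q \<in> \<alpha>" "fst p \<noteq> fst q"
      then show "fst p \<inter> fst q = {}"
        using R by metis
    qed
  qed (use R in auto)
  moreover have "v \<le> card B - 1" if "(B, v) \<in> \<alpha>" for B v
    using R that by fastforce
  ultimately show ?L
    by (auto simp: weighted_partitions_def)
qed

context
  fixes \<alpha> :: wpartition and n :: nat
  assumes \<alpha>: "\<alpha> \<in> weighted_partitions n"
begin

lemma wp_block:
  assumes "p \<in> \<alpha>"
  shows "fst p \<noteq> {}" "fst p \<subseteq> {1..n}" "finite (fst p)" "snd p < card (fst p)"
    "Min (fst p) \<in> fst p" "1 \<le> Min (fst p)" "Min (fst p) \<le> n"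
proof -
  show *: "fst p \<noteq> {}" "fst p \<subseteq> {1..n}" "snd p < card (fst p)"
    using \<alpha> assms by (auto simp: weighted_partitions_iff)
  then show "finite (fst p)"
    using finite_subset by blast
  then show "Min (fst p) \<in> fst p"
    using * by simp
  then show "1 \<le> Min (fst p)" "Min (fst p) \<le> n"
    using * by auto
qed

lemma wp_cover: "x \<in> {1..n} \<Longrightarrow> \<exists>p\<in>\<alpha>. x \<in> fst p"
  using \<alpha> unfolding weighted_partitions_iff by (metis UN_iff)

lemma wp_unique: "p \<in> \<alpha> \<Longrightarrow> q \<in> \<alpha> \<Longrightarrow> x \<in> fst p \<Longrightarrow> x \<in> fst q \<Longrightarrow> p = q"
  using \<alpha> unfolding weighted_partitions_iff by blast

lemma wp_Min_inj: "p \<in> \<alpha> \<Longrightarrow> q \<in> \<alpha> \<Longrightarrow> Min (fst p) = Min (fst q) \<Longrightarrow> p = q"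
  using wp_unique[of p q "Min (fst p)"] wp_block(5)[of p] wp_block(5)[of q] by simp

lemma wp_finite: "finite \<alpha>"
proof -
  have "\<alpha> \<subseteq> Pow {1..n} \<times> {..n}"
  proof
    fix p assume p: "p \<in> \<alpha>"
    have "card (fst p) \<le> n"
      using card_mono[OF _ wp_block(2)[OF p]] by simp
    then show "p \<in> Pow {1..n} \<times> {..n}"
      using wp_block(2,4)[OF p] by (auto simp: mem_Times_iff)
  qed
  then show ?thesis
    by (rule finite_subset) simp
qed

end

lemma finite_weighted_partitions: "finite (weighted_partitions n)"
proof (rule finite_subset)
  show "weighted_partitions n \<subseteq> Pow (Pow {1..n} \<times> {..n})"
  proof (intro subsetI PowI)
    fix \<alpha> p assume \<alpha>: "\<alpha> \<in> weighted_partitions n" and p: "p \<in> \<alpha>"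
    have "card (fst p) \<le> n"
      using card_mono[OF _ wp_block(2)[OF \<alpha> p]] by simp
    then show "p \<in> Pow {1..n} \<times> {..n}"
      using wp_block(2,4)[OF \<alpha> p] by (auto simp: mem_Times_iff)
  qed
qed simp

section \<open>Merging two blocks\<close>

definition merge :: "wpartition \<Rightarrow> nat set \<times> nat \<Rightarrow> nat set \<times> nat \<Rightarrow> nat \<Rightarrow> wpartition" where
  "merge \<alpha> p q u = insert (fst p \<union> fst q, snd p + snd q + u) (\<alpha> - {p, q})"

definition below :: "wpartition \<Rightarrow> nat set \<Rightarrow> wpartition" where
  "below \<alpha> B = {p \<in> \<alpha>. fst p \<subseteq> B}"

text \<open>Taking \<open>B = UNIV\<close> gives the total weight, from which the weight increment
  of a merge is read off.\<close>

definition weight_below :: "wpartition \<Rightarrow> nat set \<Rightarrow> nat" where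
  "weight_below \<alpha> B = (\<Sum>p\<in>below \<alpha> B. snd p)"

lemma merge_commute: "merge \<alpha> p q u = merge \<alpha> q p u"
  by (simp add: merge_def insert_commute Un_commute add.commute)

lemma below_UNIV [simp]: "below \<alpha> UNIV = \<alpha>"
  by (simp add: below_def)

context
  fixes \<alpha> :: wpartition and n :: nat and p q :: "nat set \<times> nat"
  assumes \<alpha>: "\<alpha> \<in> weighted_partitions n" and pq: "p \<in> \<alpha>" "q \<in> \<alpha>" "p \<noteq> q"
begin

lemma merged_block_fresh: "(fst p \<union> fst q, w) \<notin> \<alpha>"
proof
  assume r: "(fst p \<union> fst q, w) \<in> \<alpha>"
  have "(fst p \<union> fst q, w) = p"
    using wp_block(5)[OF \<alpha> pq(1)] by (intro wp_unique[OF \<alpha> r pq(1), of "Min (fst p)"]) auto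
  moreover have "(fst p \<union> fst q, w) = q"
    using wp_block(5)[OF \<alpha> pq(2)] by (intro wp_unique[OF \<alpha> r pq(2), of "Min (fst q)"]) auto
  ultimately show False
    using pq(3) by simp
qed

lemma merge_weighted_partitions:
  assumes "u \<le> 1"
  shows "merge \<alpha> p q u \<in> weighted_partitions n"
proof -
  have disj: "fst p \<inter> fst q = {}"
    using \<alpha> pq by (auto simp: weighted_partitions_iff)
  have "card (fst p \<union> fst q) = card (fst p) + card (fst q)"
    using disj wp_block(3)[OF \<alpha>] pq by (intro card_Un_disjoint) auto
  moreover have "snd p < card (fst p)" "snd q < card (fst q)"
    using wp_block(4)[OF \<alpha>] pq by auto
  ultimately have w: "snd p + snd q + u < card (fst p \<union> fst q)"
    using assms by linarith
  have un: "\<Union>(fst ` merge \<alpha> p q u) = {1..n}"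
  proof -
    have "\<Union>(fst ` merge \<alpha> p q u) = \<Union>(fst ` \<alpha>)"
      using pq by (auto simp: merge_def)
    then show ?thesis
      using \<alpha> by (simp add: weighted_partitions_iff)
  qed
  have sep: "(fst p \<union> fst q) \<inter> fst r = {}" if "r \<in> \<alpha> - {p, q}" for r
    using wp_unique[OF \<alpha>, of r p] wp_unique[OF \<alpha>, of r q] that pq by blast
  have "fst p \<noteq> {}"
    using wp_block(1)[OF \<alpha>] pq by auto
  show ?thesis
    unfolding weighted_partitions_iff
  proof (intro conjI ballI impI)
    fix r assume r: "r \<in> merge \<alpha> p q u"
    show "fst r \<noteq> {}" "snd r < card (fst r)"
      using r w \<open>fst p \<noteq> {}\<close> wp_block[OF \<alpha>, of r] by (auto simp: merge_def)
    fix s assume s: "s \<in> merge \<alpha> p q u" "r \<noteq> s"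
    have "fst r \<inter> fst s = {}" if "r \<in> \<alpha>" "s \<in> \<alpha>"
      using wp_unique[OF \<alpha>, of r s] that s by blast
    then show "fst r \<inter> fst s = {}"
      using r s sep[of r] sep[of s] unfolding merge_def by (auto simp: Int_commute)
  qed (rule un)
qed

text \<open>With W for the weight and c for the number of blocks inside \<open>B\<close>, the
  admissible weights W, ..., W + c - 1 lose their largest value for \<open>u = 0\<close> and their
  smallest for \<open>u = 1\<close>.\<close>

lemma below_merge_in:
  assumes "fst p \<subseteq> B" "fst q \<subseteq> B"
  shows "weight_below (merge \<alpha> p q u) B = weight_below \<alpha> B + u"
    and "Suc (card (below (merge \<alpha> p q u) B)) = card (below \<alpha> B)"
proof -
  let ?N = "(fst p \<union> fst q, snd p + snd q + u)"
  let ?R = "below \<alpha> B - {p, q}"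
  have fin: "finite (below \<alpha> B)" "finite ?R"
    using wp_finite[OF \<alpha>] by (auto simp: below_def)
  have new: "?N \<notin> ?R"
    using merged_block_fresh by (auto simp: below_def)
  have eq: "below (merge \<alpha> p q u) B = insert ?N ?R"
    using assms by (auto simp: below_def merge_def)
  have old: "below \<alpha> B = insert p (insert q ?R)"
    using assms pq by (auto simp: below_def)
  have "weight_below \<alpha> B = snd p + (snd q + (\<Sum>r\<in>?R. snd r))"
    unfolding weight_below_def by (subst old) (use fin pq in simp)
  then show "weight_below (merge \<alpha> p q u) B = weight_below \<alpha> B + u"
    unfolding weight_below_def eq using fin new by simp
  have "card (below \<alpha> B) = Suc (Suc (card ?R))"
    by (subst old) (use fin pq in simp)
  then show "Suc (card (below (merge \<alpha> p q u) B)) = card (below \<alpha> B)"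
    unfolding eq using fin new by simp
qed

lemma card_merge: "Suc (card (merge \<alpha> p q u)) = card \<alpha>"
  using below_merge_in(2)[of UNIV] by simp

lemma below_merge_out:
  assumes "\<not> fst p \<subseteq> B" "\<not> fst q \<subseteq> B"
  shows "below (merge \<alpha> p q u) B = below \<alpha> B"
  using assms by (auto simp: below_def merge_def)

end

text \<open>Disjointness of nonempty blocks forces the set \<open>S\<close> in the definition to
  consist of all blocks of \<alpha> inside \<open>B\<close>, and refinement makes these cover
  \<open>B\<close>. Condition (b) thus becomes one range condition for each block of
  \<beta>.\<close>

lemma weighted_partition_order_iff:
  "(\<alpha>, \<beta>) \<in> weighted_partition_order n \<longleftrightarrow>
     \<alpha> \<in> weighted_partitions n \<and> \<beta> \<in> weighted_partitions n \<and>
     (\<forall>p\<in>\<alpha>. \<exists>q\<in>\<beta>. fst p \<subseteq> fst q) \<and>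
     (\<forall>q\<in>\<beta>. weight_below \<alpha> (fst q) \<le> snd q \<and>
       snd q < weight_below \<alpha> (fst q) + card (below \<alpha> (fst q)))"
  (is "?L \<longleftrightarrow> ?\<alpha> \<and> ?\<beta> \<and> ?ref \<and> ?w")
proof (cases "?\<alpha> \<and> ?\<beta> \<and> ?ref")
  case True
  then have \<alpha>: ?\<alpha> and \<beta>: ?\<beta> and ref: ?ref
    by auto
  have part: "partition_on {1..n} (fst ` \<alpha>)" "partition_on {1..n} (fst ` \<beta>)"
    using \<alpha> \<beta> by (auto simp: weighted_partitions_def)
  have un: "fst q = \<Union>(fst ` below \<alpha> (fst q))" if q: "q \<in> \<beta>" for q
  proof
    show "fst q \<subseteq> \<Union>(fst ` below \<alpha> (fst q))"
    proof
      fix x assume x: "x \<in> fst q"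
      then obtain p where p: "p \<in> \<alpha>" "x \<in> fst p"
        using wp_cover[OF \<alpha>, of x] wp_block(2)[OF \<beta> q] by blast
      then obtain q' where q': "q' \<in> \<beta>" "fst p \<subseteq> fst q'"
        using ref by blast
      then have "q' = q"
        using wp_unique[OF \<beta> q'(1) q, of x] p x by blast
      then have "p \<in> below \<alpha> (fst q)"
        using p q' by (simp add: below_def)
      then show "x \<in> \<Union>(fst ` below \<alpha> (fst q))"
        using p(2) by blast
    qed
  qed (auto simp: below_def)
  have eq: "S = below \<alpha> B" if S: "S \<subseteq> \<alpha>" "B = \<Union>(fst ` S)" for S B
  proof
    show "S \<subseteq> below \<alpha> B"
      using S by (auto simp: below_def)
    show "below \<alpha> B \<subseteq> S"
    proof
      fix p assume "p \<in> below \<alpha> B"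
      then have p: "p \<in> \<alpha>" "fst p \<subseteq> B"
        by (auto simp: below_def)
      then obtain p' where "p' \<in> S" "Min (fst p) \<in> fst p'"
        using wp_block(5)[OF \<alpha> p(1)] S(2) by blast
      then show "p \<in> S"
        using wp_unique[OF \<alpha> p(1), of p' "Min (fst p)"] wp_block(5)[OF \<alpha> p(1)] S by auto
    qed
  qed
  have "?L \<longleftrightarrow> (\<forall>(B, v)\<in>\<beta>. \<forall>S\<subseteq>\<alpha>. B = \<Union>(fst ` S) \<longrightarrow>
           int v - (\<Sum>(A, w)\<in>S. int w) \<in> {0..int (card S) - 1})"
    using True part by (auto simp: weighted_partition_order_def refines_def)
  also have "\<dots> \<longleftrightarrow> (\<forall>q\<in>\<beta>. int (snd q) - (\<Sum>p\<in>below \<alpha> (fst q). int (snd p))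
      \<in> {0..int (card (below \<alpha> (fst q))) - 1})" (is "?X \<longleftrightarrow> ?Y")
  proof
    assume X: ?X
    show ?Y
    proof
      fix q assume q: "q \<in> \<beta>"
      have "below \<alpha> (fst q) \<subseteq> \<alpha>"
        by (auto simp: below_def)
      then show "int (snd q) - (\<Sum>p\<in>below \<alpha> (fst q). int (snd p))
          \<in> {0..int (card (below \<alpha> (fst q))) - 1}"
        using X[rule_format, OF q] un[OF q] by (auto simp: case_prod_unfold)
    qed
  next
    assume Y: ?Y
    show ?X
      using Y eq by (fastforce simp: case_prod_unfold)
  qed
  also have "\<dots> \<longleftrightarrow> ?w"
    by (intro ball_cong refl) (auto simp: weight_below_def simp flip: of_nat_sum)
  finally show ?thesis
    using True by blast
next
  case False
  then show ?thesis
    by (auto simp: weighted_partition_order_def refines_def)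
qed

lemma below_block:
  assumes "\<alpha> \<in> weighted_partitions n" "q \<in> \<alpha>"
  shows "below \<alpha> (fst q) = {q}"
proof -
  have "p = q" if "p \<in> \<alpha>" "fst p \<subseteq> fst q" for p
    using wp_unique[OF assms(1) that(1) assms(2), of "Min (fst p)"] wp_block(5)[OF assms(1) that(1)] that(2)
    by blast
  then show ?thesis
    using assms(2) unfolding below_def by blast
qed

lemma weighted_partition_order_refl:
  "\<alpha> \<in> weighted_partitions n \<Longrightarrow> (\<alpha>, \<alpha>) \<in> weighted_partition_order n"
  by (auto simp: weighted_partition_order_iff below_block weight_below_def)

text \<open>A merge narrows the range of admissible weights of the single target block
  \<open>s0\<close> that contains both blocks and leaves all other ranges unchanged.\<close>

lemma weighted_partition_order_merge:
  assumes \<alpha>: "\<alpha> \<in> weighted_partitions n" and p: "p \<in> \<alpha>" and q: "q \<in> \<alpha>" "p \<noteq> q" and u: "u \<le> 1"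
    and le: "(merge \<alpha> p q u, \<beta>) \<in> weighted_partition_order n"
  shows "(\<alpha>, \<beta>) \<in> weighted_partition_order n"
proof -
  let ?\<gamma> = "merge \<alpha> p q u"
  have \<beta>: "\<beta> \<in> weighted_partitions n" and ref: "\<And>r. r \<in> ?\<gamma> \<Longrightarrow> \<exists>s\<in>\<beta>. fst r \<subseteq> fst s"
    and w: "\<And>s. s \<in> \<beta> \<Longrightarrow> weight_below ?\<gamma> (fst s) \<le> snd s \<and>
      snd s < weight_below ?\<gamma> (fst s) + card (below ?\<gamma> (fst s))"
    using le by (auto simp: weighted_partition_order_iff)
  obtain s0 where s0: "s0 \<in> \<beta>" "fst p \<union> fst q \<subseteq> fst s0"
    using ref[of "(fst p \<union> fst q, snd p + snd q + u)"] by (auto simp: merge_def)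
  have "\<exists>s\<in>\<beta>. fst r \<subseteq> fst s" if "r \<in> \<alpha>" for r
    using s0 ref[of r] that by (cases "r \<in> {p, q}") (auto simp: merge_def)
  moreover have "weight_below \<alpha> (fst s) \<le> snd s \<and>
      snd s < weight_below \<alpha> (fst s) + card (below \<alpha> (fst s))" if s: "s \<in> \<beta>" for s
  proof (cases "s = s0")
    case True
    then show ?thesis
      using below_merge_in[OF \<alpha> p q, of "fst s" u] s0 w[OF s] u by auto
  next
    case False
    then have "fst s \<inter> fst s0 = {}"
      using wp_unique[OF \<beta> s s0(1)] by blast
    then have "\<not> fst p \<subseteq> fst s" "\<not> fst q \<subseteq> fst s"
      using s0(2) wp_block(1)[OF \<alpha> p] wp_block(1)[OF \<alpha> q(1)] by blast+
    then show ?thesis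
      using below_merge_out[OF \<alpha> p q, of "fst s" u] w[OF s] by (simp add: weight_below_def)
  qed
  ultimately show ?thesis
    using \<alpha> \<beta> by (simp add: weighted_partition_order_iff)
qed

lemma weighted_partition_order_first_merge:
  assumes le: "(\<alpha>, \<beta>) \<in> weighted_partition_order n" and ne: "\<alpha> \<noteq> \<beta>"
  obtains p q u where "p \<in> \<alpha>" "q \<in> \<alpha>" "Min (fst p) < Min (fst q)" "u \<le> 1"
    "(merge \<alpha> p q u, \<beta>) \<in> weighted_partition_order n"
proof -
  have \<alpha>: "\<alpha> \<in> weighted_partitions n" and \<beta>: "\<beta> \<in> weighted_partitions n"
    and ref: "\<And>p. p \<in> \<alpha> \<Longrightarrow> \<exists>s\<in>\<beta>. fst p \<subseteq> fst s"
    and w: "\<And>s. s \<in> \<beta> \<Longrightarrow> weight_below \<alpha> (fst s) \<le> snd s \<and>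
      snd s < weight_below \<alpha> (fst s) + card (below \<alpha> (fst s))"
    using le by (auto simp: weighted_partition_order_iff)
  \<comment> \<open>If every block of \<beta> contained just one block of \<alpha>, each range would
    have one value only, and weights as well as blocks would coincide.\<close>
  have "\<exists>s\<in>\<beta>. \<exists>p\<in>below \<alpha> (fst s). \<exists>q\<in>below \<alpha> (fst s). p \<noteq> q"
  proof (rule ccontr)
    assume no: "\<not> ?thesis"
    have single: "below \<alpha> (fst s) = {s}" if s: "s \<in> \<beta>" for s
    proof -
      have "below \<alpha> (fst s) \<noteq> {}"
        using w[OF s] by auto
      then obtain p where p: "below \<alpha> (fst s) = {p}"
        using no s by blast
      then have "snd p = snd s"
        using w[OF s] by (simp add: weight_below_def)
      moreover have "fst s \<subseteq> fst p"
      proof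
        fix x assume x: "x \<in> fst s"
        then obtain r where r: "r \<in> \<alpha>" "x \<in> fst r"
          using wp_cover[OF \<alpha>, of x] wp_block(2)[OF \<beta> s] by blast
        then obtain t where t: "t \<in> \<beta>" "fst r \<subseteq> fst t"
          using ref by blast
        then have "t = s"
          using wp_unique[OF \<beta> t(1) s, of x] r x by blast
        then have "r = p"
          using p r t by (auto simp: below_def)
        then show "x \<in> fst p"
          using r by simp
      qed
      moreover have "fst p \<subseteq> fst s"
        using p by (auto simp: below_def)
      ultimately have "p = s"
        by (simp add: prod_eq_iff)
      then show ?thesis
        using p by simp
    qed
    have "\<alpha> = \<beta>"
    proof
      show "\<beta> \<subseteq> \<alpha>"
        using single by (auto simp: below_def)
      show "\<alpha> \<subseteq> \<beta>"
      proof
        fix p assume p: "p \<in> \<alpha>"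
        then obtain s where s: "s \<in> \<beta>" "fst p \<subseteq> fst s"
          using ref by blast
        then have "p \<in> below \<alpha> (fst s)"
          using p by (simp add: below_def)
        then show "p \<in> \<beta>"
          using single[OF s(1)] s(1) by simp
      qed
    qed
    then show False
      using ne by simp
  qed
  then obtain s p' q' where s: "s \<in> \<beta>" and p'q': "p' \<in> below \<alpha> (fst s)" "q' \<in> below \<alpha> (fst s)" "p' \<noteq> q'"
    by blast
  then have "Min (fst p') \<noteq> Min (fst q')"
    using wp_Min_inj[OF \<alpha>, of p' q'] by (auto simp: below_def)
  then obtain p q where pq: "p \<in> below \<alpha> (fst s)" "q \<in> below \<alpha> (fst s)" "Min (fst p) < Min (fst q)"
    using p'q' by (metis linorder_neqE_nat)
  then have p: "p \<in> \<alpha>" "fst p \<subseteq> fst s" and q: "q \<in> \<alpha>" "fst q \<subseteq> fst s" "p \<noteq> q"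
    by (auto simp: below_def)
  \<comment> \<open>The target weight must stay in the narrowed range: at the bottom of the range
    only its top may be given up, and above the bottom the smallest value can be spared.\<close>
  define u where "u = (if snd s = weight_below \<alpha> (fst s) then 0 else 1 :: nat)"
  have u: "u \<le> 1"
    by (simp add: u_def)
  let ?\<gamma> = "merge \<alpha> p q u"
  have "finite (below \<alpha> (fst s))"
    using wp_finite[OF \<alpha>] by (simp add: below_def)
  then have two: "2 \<le> card (below \<alpha> (fst s))"
    using card_mono[of "below \<alpha> (fst s)" "{p, q}"] pq q(3) by simp
  have "\<exists>t\<in>\<beta>. fst r \<subseteq> fst t" if "r \<in> ?\<gamma>" for r
  proof (cases "r \<in> \<alpha>")
    case False
    then have "fst r = fst p \<union> fst q"
      using that by (auto simp: merge_def)
    then show ?thesis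
      using s p q by auto
  qed (rule ref)
  moreover have "weight_below ?\<gamma> (fst t) \<le> snd t \<and>
      snd t < weight_below ?\<gamma> (fst t) + card (below ?\<gamma> (fst t))" if t: "t \<in> \<beta>" for t
  proof (cases "t = s")
    case True
    then show ?thesis
      using below_merge_in[OF \<alpha> p(1) q(1,3), of "fst s" u] p(2) q(2) w[OF s] two by (auto simp: u_def)
  next
    case False
    then have "fst t \<inter> fst s = {}"
      using wp_unique[OF \<beta> t s] by blast
    then have "\<not> fst p \<subseteq> fst t" "\<not> fst q \<subseteq> fst t"
      using p q wp_block(1)[OF \<alpha> p(1)] wp_block(1)[OF \<alpha> q(1)] by blast+
    then show ?thesis
      using below_merge_out[OF \<alpha> p(1) q(1,3), of "fst t" u] w[OF t] by (simp add: weight_below_def)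
  qed
  ultimately have "(?\<gamma>, \<beta>) \<in> weighted_partition_order n"
    using merge_weighted_partitions[OF \<alpha> p(1) q(1,3) u] \<beta> by (simp add: weighted_partition_order_iff)
  then show ?thesis
    using that p q u pq by blast
qed

section \<open>The order as generated by merges\<close>

definition merge_step :: "nat \<Rightarrow> wpartition \<Rightarrow> wpartition \<Rightarrow> bool" where
  "merge_step n \<alpha> \<beta> \<longleftrightarrow> \<alpha> \<in> weighted_partitions n \<and>
     (\<exists>p\<in>\<alpha>. \<exists>q\<in>\<alpha>. \<exists>u\<le>1. Min (fst p) < Min (fst q) \<and> \<beta> = merge \<alpha> p q u)"

lemma merge_step_weighted_partitions:
  assumes "merge_step n \<alpha> \<beta>"
  shows "\<alpha> \<in> weighted_partitions n" "\<beta> \<in> weighted_partitions n"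
  using assms merge_weighted_partitions by (fastforce simp: merge_step_def)+

lemma merge_step_card: "merge_step n \<alpha> \<beta> \<Longrightarrow> card \<alpha> = Suc (card \<beta>)"
  using card_merge by (fastforce simp: merge_step_def)

lemma rtranclp_merge_step_imp_order:
  assumes "(merge_step n)\<^sup>*\<^sup>* \<alpha> \<beta>" and "\<beta> \<in> weighted_partitions n"
  shows "(\<alpha>, \<beta>) \<in> weighted_partition_order n"
  using assms
proof (induction rule: converse_rtranclp_induct)
  case base
  then show ?case
    by (rule weighted_partition_order_refl)
next
  case (step \<alpha> \<gamma>)
  then show ?case
    by (auto simp: merge_step_def intro: weighted_partition_order_merge)
qed

lemma weighted_partition_order_eq_rtranclp:
  "(\<alpha>, \<beta>) \<in> weighted_partition_order n \<longleftrightarrow>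
     \<alpha> \<in> weighted_partitions n \<and> \<beta> \<in> weighted_partitions n \<and> (merge_step n)\<^sup>*\<^sup>* \<alpha> \<beta>"
proof
  assume "(\<alpha>, \<beta>) \<in> weighted_partition_order n"
  then have "(merge_step n)\<^sup>*\<^sup>* \<alpha> \<beta>"
  proof (induction "card \<alpha>" arbitrary: \<alpha> rule: less_induct)
    case less
    show ?case
    proof (cases "\<alpha> = \<beta>")
      case False
      have \<alpha>: "\<alpha> \<in> weighted_partitions n"
        using less.prems by (simp add: weighted_partition_order_iff)
      obtain p q u where pq: "p \<in> \<alpha>" "q \<in> \<alpha>" "Min (fst p) < Min (fst q)" "u \<le> 1"
        "(merge \<alpha> p q u, \<beta>) \<in> weighted_partition_order n"
        using weighted_partition_order_first_merge[OF less.prems False] .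
      then have step: "merge_step n \<alpha> (merge \<alpha> p q u)"
        using \<alpha> by (auto simp: merge_step_def)
      have "(merge_step n)\<^sup>*\<^sup>* (merge \<alpha> p q u) \<beta>"
        using less.hyps[of "merge \<alpha> p q u"] merge_step_card[OF step] pq(5) by simp
      with step show ?thesis
        by (rule converse_rtranclp_into_rtranclp)
    qed simp
  qed
  then show "\<alpha> \<in> weighted_partitions n \<and> \<beta> \<in> weighted_partitions n \<and> (merge_step n)\<^sup>*\<^sup>* \<alpha> \<beta>"
    using \<open>(\<alpha>, \<beta>) \<in> weighted_partition_order n\<close> by (simp add: weighted_partition_order_iff)
qed (simp add: rtranclp_merge_step_imp_order)

section \<open>The labelling\<close>

definition block_mins :: "wpartition \<Rightarrow> nat set" where
  "block_mins \<alpha> = (\<lambda>p. Min (fst p)) ` \<alpha>"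

text \<open>The union merely extracts the unique block that contains \<open>x\<close>.\<close>

definition min_of_block :: "wpartition \<Rightarrow> nat \<Rightarrow> nat" where
  "min_of_block \<alpha> x = Min (\<Union>{B \<in> fst ` \<alpha>. x \<in> B})"

text \<open>
  The label of the step that merges blocks with minima \<open>a < b\<close> and adds \<open>u\<close> to the weight is
  \<open>(a, b, u)\<close>.
\<close>

definition label_b :: "wpartition \<Rightarrow> wpartition \<Rightarrow> nat" where
  "label_b \<alpha> \<beta> = Min (block_mins \<alpha> - block_mins \<beta>)"

definition label_a :: "wpartition \<Rightarrow> wpartition \<Rightarrow> nat" where
  "label_a \<alpha> \<beta> = min_of_block \<beta> (label_b \<alpha> \<beta>)"

definition label_u :: "wpartition \<Rightarrow> wpartition \<Rightarrow> nat" where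
  "label_u \<alpha> \<beta> = weight_below \<beta> UNIV - weight_below \<alpha> UNIV"

definition label_le :: "wpartition \<Rightarrow> wpartition \<Rightarrow> wpartition \<Rightarrow> wpartition \<Rightarrow> bool" where
  "label_le \<alpha> \<beta> \<gamma> \<delta> \<longleftrightarrow> label_a \<alpha> \<beta> < label_a \<gamma> \<delta> \<or>
     label_a \<alpha> \<beta> = label_a \<gamma> \<delta> \<and> label_b \<alpha> \<beta> \<le> label_b \<gamma> \<delta> \<and> label_u \<alpha> \<beta> \<le> label_u \<gamma> \<delta>"

text \<open>The lexicographic order on \<open>(a, b, u)\<close> as a number: base
  \<open>Suc n\<close> leaves room for \<open>b \<le> n\<close>, the factor 2 for
  \<open>u \<le> 1\<close>. For such labels this total order extends the partial one behind
  \<open>label_le\<close>.\<close>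

definition label_code :: "nat \<Rightarrow> wpartition \<Rightarrow> wpartition \<Rightarrow> nat" where
  "label_code n \<alpha> \<beta> = (label_a \<alpha> \<beta> * Suc n + label_b \<alpha> \<beta>) * 2 + label_u \<alpha> \<beta>"

section \<open>Labels of single merges\<close>

lemma min_of_block_eq:
  assumes "\<alpha> \<in> weighted_partitions n" "p \<in> \<alpha>" "x \<in> fst p"
  shows "min_of_block \<alpha> x = Min (fst p)"
proof -
  have "{B \<in> fst ` \<alpha>. x \<in> B} = {fst p}"
  proof
    show "{B \<in> fst ` \<alpha>. x \<in> B} \<subseteq> {fst p}"
    proof clarify
      fix r assume "r \<in> \<alpha>" "x \<in> fst r"
      then show "fst r = fst p"
        using wp_unique[OF assms(1) _ assms(2) _ assms(3)] by metis
    qed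
  qed (use assms in auto)
  then show ?thesis
    by (simp add: min_of_block_def)
qed

lemma block_mins_merge:
  assumes \<alpha>: "\<alpha> \<in> weighted_partitions n" and pq: "p \<in> \<alpha>" "q \<in> \<alpha>" "Min (fst p) < Min (fst q)"
  shows "block_mins (merge \<alpha> p q u) = block_mins \<alpha> - {Min (fst q)}"
    and "Min (fst p \<union> fst q) = Min (fst p)"
proof -
  show *: "Min (fst p \<union> fst q) = Min (fst p)"
    using wp_block[OF \<alpha> pq(1)] wp_block[OF \<alpha> pq(2)] pq(3) by (simp add: Min_Un)
  have "Min (fst r) \<noteq> Min (fst q)" if "r \<in> \<alpha>" "r \<noteq> q" for r
    using wp_Min_inj[OF \<alpha> that(1) pq(2)] that(2) by blast
  then show "block_mins (merge \<alpha> p q u) = block_mins \<alpha> - {Min (fst q)}"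
    using pq * by (auto simp: block_mins_def merge_def)
qed

context
  fixes \<alpha> \<beta> :: wpartition and n u :: nat and p q :: "nat set \<times> nat"
  assumes \<alpha>: "\<alpha> \<in> weighted_partitions n" and pq: "p \<in> \<alpha>" "q \<in> \<alpha>" "Min (fst p) < Min (fst q)"
    and u: "u \<le> 1" and \<beta>_eq: "\<beta> = merge \<alpha> p q u"
begin

lemma label_merge:
  "label_a \<alpha> \<beta> = Min (fst p)" "label_b \<alpha> \<beta> = Min (fst q)" "label_u \<alpha> \<beta> = u"
proof -
  have pq_ne: "p \<noteq> q"
    using pq by auto
  have "block_mins \<alpha> - block_mins \<beta> = {Min (fst q)}"
    using block_mins_merge(1)[OF \<alpha> pq] pq by (auto simp: \<beta>_eq block_mins_def)
  then show b: "label_b \<alpha> \<beta> = Min (fst q)"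
    by (simp add: label_b_def)
  have "\<beta> \<in> weighted_partitions n"
    using merge_weighted_partitions[OF \<alpha> pq(1,2) pq_ne u] by (simp add: \<beta>_eq)
  moreover have "(fst p \<union> fst q, snd p + snd q + u) \<in> \<beta>"
    by (simp add: \<beta>_eq merge_def)
  ultimately show "label_a \<alpha> \<beta> = Min (fst p)"
    using block_mins_merge(2)[OF \<alpha> pq] wp_block(5)[OF \<alpha> pq(2)]
    by (simp add: label_a_def b min_of_block_eq)
  show "label_u \<alpha> \<beta> = u"
    using below_merge_in(1)[OF \<alpha> pq(1,2) pq_ne, of UNIV u] by (simp add: label_u_def \<beta>_eq)
qed

end

lemma merge_stepE:
  assumes "merge_step n \<alpha> \<beta>"
  obtains p q where "p \<in> \<alpha>" "q \<in> \<alpha>" "p \<noteq> q" "Min (fst p) < Min (fst q)" "label_u \<alpha> \<beta> \<le> 1"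
    "\<beta> = merge \<alpha> p q (label_u \<alpha> \<beta>)" "label_a \<alpha> \<beta> = Min (fst p)" "label_b \<alpha> \<beta> = Min (fst q)"
proof -
  obtain p q u where "\<alpha> \<in> weighted_partitions n" "p \<in> \<alpha>" "q \<in> \<alpha>" "Min (fst p) < Min (fst q)" "u \<le> 1"
    "\<beta> = merge \<alpha> p q u"
    using assms by (auto simp: merge_step_def)
  then show thesis
    using that[of p q] label_merge[of \<alpha> n p q u \<beta>] by auto
qed

lemma label_code_less:
  assumes "label_b \<alpha> \<beta> \<le> n" "label_u \<alpha> \<beta> \<le> 1"
    and "label_a \<alpha> \<beta> < label_a \<gamma> \<delta> \<or> label_a \<alpha> \<beta> = label_a \<gamma> \<delta> \<and>
      (label_b \<alpha> \<beta> < label_b \<gamma> \<delta> \<or> label_b \<alpha> \<beta> = label_b \<gamma> \<delta> \<and> label_u \<alpha> \<beta> < label_u \<gamma> \<delta>)"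
  shows "label_code n \<alpha> \<beta> < label_code n \<gamma> \<delta>"
  using assms(3)
proof (elim disjE)
  assume "label_a \<alpha> \<beta> < label_a \<gamma> \<delta>"
  then have "Suc (label_a \<alpha> \<beta>) * Suc n \<le> label_a \<gamma> \<delta> * Suc n"
    by (intro mult_le_mono1) simp
  then have "label_a \<alpha> \<beta> * Suc n + label_b \<alpha> \<beta> < label_a \<gamma> \<delta> * Suc n + label_b \<gamma> \<delta>"
    using assms(1) by simp
  moreover have "x * 2 + u < y * 2 + v" if "x < y" "u \<le> 1" for x y u v :: nat
    using that by simp
  ultimately show ?thesis
    using assms(2) unfolding label_code_def by blast
qed (use assms(2) in \<open>auto simp: label_code_def\<close>)

text \<open>The right-hand side is symmetric in the two merges, which can therefore be
  exchanged.\<close>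

lemma merge_merge_disjoint:
  assumes "\<alpha> \<in> weighted_partitions n" "p \<in> \<alpha>" "q \<in> \<alpha>" "p \<noteq> q" "r \<in> \<alpha> - {p, q}" "s \<in> \<alpha> - {p, q}"
  shows "merge (merge \<alpha> p q u) r s v =
    insert (fst r \<union> fst s, snd r + snd s + v) (insert (fst p \<union> fst q, snd p + snd q + u) (\<alpha> - {p, q, r, s}))"
proof -
  let ?N = "(fst p \<union> fst q, snd p + snd q + u)"
  have "?N \<notin> \<alpha>"
    by (rule merged_block_fresh) (use assms in auto)
  then have "insert ?N (\<alpha> - {p, q}) - {r, s} = insert ?N (\<alpha> - {p, q, r, s})"
    using assms(5,6) by auto
  then show ?thesis
    by (simp add: merge_def)
qed

text \<open>Only the union of the three blocks and the sum \<open>u + v\<close> survive, so any two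
  of the blocks may be merged first, with the increments in either order.\<close>

lemma merge_merge_block:
  assumes "\<alpha> \<in> weighted_partitions n" "p \<in> \<alpha>" "q \<in> \<alpha>" "p \<noteq> q" "r \<in> \<alpha>"
  shows "merge (merge \<alpha> p q u) (fst p \<union> fst q, snd p + snd q + u) r v =
    insert (fst p \<union> fst q \<union> fst r, snd p + snd q + snd r + (u + v)) (\<alpha> - {p, q, r})"
proof -
  let ?N = "(fst p \<union> fst q, snd p + snd q + u)"
  have "?N \<notin> \<alpha>"
    by (rule merged_block_fresh) (use assms in auto)
  then have "insert ?N (\<alpha> - {p, q}) - {?N, r} = \<alpha> - {p, q, r}"
    by auto
  then show ?thesis
    by (simp add: merge_def algebra_simps)
qed

lemma merge_step_mergeI:
  "\<alpha> \<in> weighted_partitions n \<Longrightarrow> p \<in> \<alpha> \<Longrightarrow> q \<in> \<alpha> \<Longrightarrow> Min (fst p) < Min (fst q) \<Longrightarrow> u \<le> 1 \<Longrightarrow>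
    merge_step n \<alpha> (merge \<alpha> p q u)"
  by (auto simp: merge_step_def)

text \<open>The second merge either avoids the block \<open>?N\<close> created by the first one, or
  enlarges it by a block with larger minimum, or adds it to a block with smaller minimum. Each case
  has its own way to reroute the two merges.\<close>

lemma merge_step_descent:
  assumes s1: "merge_step n \<alpha> \<beta>" and s2: "merge_step n \<beta> \<gamma>" and desc: "\<not> label_le \<alpha> \<beta> \<beta> \<gamma>"
  shows "\<exists>\<beta>'. merge_step n \<alpha> \<beta>' \<and> merge_step n \<beta>' \<gamma> \<and> label_code n \<alpha> \<beta>' < label_code n \<alpha> \<beta>"
proof -
  have \<alpha>: "\<alpha> \<in> weighted_partitions n" and \<beta>: "\<beta> \<in> weighted_partitions n"
    using s1 s2 by (auto simp: merge_step_def)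
  obtain p q where pq: "p \<in> \<alpha>" "q \<in> \<alpha>" "p \<noteq> q" "Min (fst p) < Min (fst q)"
    and u: "label_u \<alpha> \<beta> \<le> 1" and \<beta>_eq: "\<beta> = merge \<alpha> p q (label_u \<alpha> \<beta>)"
    and ab: "label_a \<alpha> \<beta> = Min (fst p)" "label_b \<alpha> \<beta> = Min (fst q)"
    using s1 by (rule merge_stepE)
  obtain r s where rs: "r \<in> \<beta>" "s \<in> \<beta>" "r \<noteq> s" "Min (fst r) < Min (fst s)"
    and v: "label_u \<beta> \<gamma> \<le> 1" and \<gamma>_eq: "\<gamma> = merge \<beta> r s (label_u \<beta> \<gamma>)"
    and cd: "label_a \<beta> \<gamma> = Min (fst r)" "label_b \<beta> \<gamma> = Min (fst s)"
    using s2 by (rule merge_stepE)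
  define u v where "u = label_u \<alpha> \<beta>" and "v = label_u \<beta> \<gamma>"
  note [simp] = u_def[symmetric] v_def[symmetric]
  note \<beta>_eq = \<beta>_eq[simplified] and \<gamma>_eq = \<gamma>_eq[simplified] and uv = u[simplified] v[simplified]
  let ?N = "(fst p \<union> fst q, snd p + snd q + u)"
  have MinN: "Min (fst p \<union> fst q) = Min (fst p)"
    by (rule block_mins_merge(2)[OF \<alpha> pq(1,2,4)])
  have improve: ?thesis
    if "p' \<in> \<alpha>" "q' \<in> \<alpha>" "Min (fst p') < Min (fst q')" "u' \<le> 1" "merge_step n (merge \<alpha> p' q' u') \<gamma>"
      and less: "Min (fst p') < Min (fst p) \<or> Min (fst p') = Min (fst p) \<and>
        (Min (fst q') < Min (fst q) \<or> Min (fst q') = Min (fst q) \<and> u' < u)" for p' q' u'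
  proof (intro exI conjI)
    note l = label_merge[OF \<alpha> that(1-4) refl]
    show "label_code n \<alpha> (merge \<alpha> p' q' u') < label_code n \<alpha> \<beta>"
      using less that(4) wp_block(7)[OF \<alpha> that(2)] by (intro label_code_less) (auto simp: l ab)
  qed (use that \<alpha> in \<open>auto intro: merge_step_mergeI\<close>)
  have Min_ne: "Min (fst x) \<noteq> Min (fst y)" if "x \<in> \<alpha>" "y \<in> \<alpha>" "x \<noteq> y" for x y
    using wp_Min_inj[OF \<alpha> that(1,2)] that(3) by blast
  have \<beta>_cases: "x = ?N \<or> x \<in> \<alpha> - {p, q}" if "x \<in> \<beta>" for x
    using that by (auto simp: \<beta>_eq merge_def)
  have keep: "x \<in> merge \<alpha> y z w" if "x \<in> \<alpha> - {y, z}" for x y z w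
    using that by (auto simp: merge_def)
  have new: "(fst x \<union> fst y, snd x + snd y + w) \<in> merge \<alpha> x y w" for x y w
    by (simp add: merge_def)
  have WP: "merge \<alpha> x y w \<in> weighted_partitions n" if "x \<in> \<alpha>" "y \<in> \<alpha>" "x \<noteq> y" "w \<le> 1" for x y w
    by (rule merge_weighted_partitions[OF \<alpha> that])
  consider (disjoint) "r \<in> \<alpha> - {p, q}" "s \<in> \<alpha> - {p, q}"
    | (first) "r = ?N" "s \<in> \<alpha> - {p, q}" | (second) "r \<in> \<alpha> - {p, q}" "s = ?N"
    using \<beta>_cases[OF rs(1)] \<beta>_cases[OF rs(2)] rs(3) by metis
  then show ?thesis
  proof cases
    \<comment> \<open>The two values of \<open>a\<close> differ, so a descent means that the second
      is smaller; the merges are exchanged.\<close>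
    case disjoint
    then have "Min (fst r) < Min (fst p)"
      using desc Min_ne[of r p] pq by (auto simp: label_le_def ab cd)
    moreover have "\<gamma> = merge (merge \<alpha> r s v) p q u"
    proof -
      have "\<gamma> = merge (merge \<alpha> p q u) r s v"
        using \<gamma>_eq \<beta>_eq by simp
      also have "\<dots> = insert (fst r \<union> fst s, snd r + snd s + v)
          (insert (fst p \<union> fst q, snd p + snd q + u) (\<alpha> - {p, q, r, s}))"
        using disjoint pq by (intro merge_merge_disjoint[OF \<alpha>]) auto
      also have "\<dots> = insert (fst p \<union> fst q, snd p + snd q + u)
          (insert (fst r \<union> fst s, snd r + snd s + v) (\<alpha> - {r, s, p, q}))"
        by auto
      also have "\<dots> = merge (merge \<alpha> r s v) p q u"
        using disjoint pq rs(3) by (intro merge_merge_disjoint[OF \<alpha>, symmetric]) auto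
      finally show ?thesis .
    qed
    moreover have "merge_step n (merge \<alpha> r s v) (merge (merge \<alpha> r s v) p q u)"
      using disjoint pq rs uv by (intro merge_step_mergeI WP keep) auto
    ultimately show ?thesis
      using disjoint rs(4) uv by (intro improve[of r s v]) auto
  next
    \<comment> \<open>As \<open>?N\<close> keeps the minimum of \<open>p\<close>, both merges have
      the same \<open>a\<close>, and the descent comes from \<open>b\<close> or from
      \<open>u\<close>.\<close>
    case first
    have \<gamma>3: "\<gamma> = insert (fst p \<union> fst q \<union> fst s, snd p + snd q + snd s + (u + v)) (\<alpha> - {p, q, s})"
      unfolding \<gamma>_eq unfolding \<beta>_eq first(1) using first pq by (intro merge_merge_block[OF \<alpha>]) auto
    have Ms: "Min (fst p) < Min (fst s)"
      using rs(4) first(1) MinN by simp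
    show ?thesis
    proof (cases "Min (fst s) < Min (fst q)")
      case True
      let ?M = "(fst p \<union> fst s, snd p + snd s + u)"
      have "merge (merge \<alpha> p s u) ?M q v =
          insert (fst p \<union> fst s \<union> fst q, snd p + snd s + snd q + (u + v)) (\<alpha> - {p, s, q})"
        using first pq by (intro merge_merge_block[OF \<alpha>]) auto
      also have "\<dots> = \<gamma>"
        unfolding \<gamma>3 by (simp add: ac_simps insert_commute)
      finally have eq: "merge (merge \<alpha> p s u) ?M q v = \<gamma>" .
      have "Min (fst ?M) < Min (fst q)"
        using block_mins_merge(2)[OF \<alpha> pq(1) _ Ms] first pq by simp
      then have "merge_step n (merge \<alpha> p s u) (merge (merge \<alpha> p s u) ?M q v)"
        using first pq uv Ms by (intro merge_step_mergeI WP new keep) auto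
      then show ?thesis
        unfolding eq using first pq uv Ms True by (intro improve[of p s u]) auto
    next
      \<comment> \<open>Here the values of \<open>b\<close> are in order, so the increments must be
        1, 0. The same merges with increments 0, 1 give the same result.\<close>
      case False
      then have uv': "u = 1" "v = 0"
        using desc first MinN uv by (auto simp: label_le_def ab cd)
      let ?M = "(fst p \<union> fst q, snd p + snd q + 0)"
      have "merge (merge \<alpha> p q 0) ?M s 1 =
          insert (fst p \<union> fst q \<union> fst s, snd p + snd q + snd s + (0 + 1)) (\<alpha> - {p, q, s})"
        using first pq by (intro merge_merge_block[OF \<alpha>]) auto
      also have "\<dots> = \<gamma>"
        unfolding \<gamma>3 by (simp add: uv')
      finally have eq: "merge (merge \<alpha> p q 0) ?M s 1 = \<gamma>" .
      have "merge_step n (merge \<alpha> p q 0) (merge (merge \<alpha> p q 0) ?M s 1)"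
        using first pq Ms MinN by (intro merge_step_mergeI WP new keep) auto
      then show ?thesis
        unfolding eq using pq by (intro improve[of p q 0]) (auto simp: uv')
    qed
  next
    \<comment> \<open>This is a descent in \<open>a\<close> for any increments. Merging
      \<open>r\<close> with \<open>p\<close> first brings the smaller minimum of \<open>r\<close>
      forward.\<close>
    case second
    have \<gamma>3: "\<gamma> = insert (fst p \<union> fst q \<union> fst r, snd p + snd q + snd r + (u + v)) (\<alpha> - {p, q, r})"
      unfolding \<gamma>_eq merge_commute[of \<beta> r] unfolding \<beta>_eq second(2)
      using second pq by (intro merge_merge_block[OF \<alpha>]) auto
    have Mr: "Min (fst r) < Min (fst p)"
      using rs(4) second(2) MinN by simp
    let ?M = "(fst r \<union> fst p, snd r + snd p + u)"
    have "merge (merge \<alpha> r p u) ?M q v =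
        insert (fst r \<union> fst p \<union> fst q, snd r + snd p + snd q + (u + v)) (\<alpha> - {r, p, q})"
      using second pq by (intro merge_merge_block[OF \<alpha>]) auto
    also have "\<dots> = \<gamma>"
      unfolding \<gamma>3 by (simp add: ac_simps insert_commute)
    finally have eq: "merge (merge \<alpha> r p u) ?M q v = \<gamma>" .
    have "Min (fst ?M) < Min (fst q)"
      using block_mins_merge(2)[OF \<alpha> _ pq(1) Mr] second pq Mr by simp
    then have "merge_step n (merge \<alpha> r p u) (merge (merge \<alpha> r p u) ?M q v)"
      using second pq uv Mr by (intro merge_step_mergeI WP new keep) auto
    then show ?thesis
      unfolding eq using second pq uv Mr by (intro improve[of r p u]) auto
  qed
qed

text \<open>
  In an ascending path to \<open>\<beta>\<close>, no \<open>a\<close> is absorbed later on. So each \<open>a\<close> is the minimum of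
  its block in \<open>\<beta>\<close>, and the pairs \<open>(a, b)\<close> are those of \<open>b\<close> in
  \<open>block_mins \<alpha> - block_mins \<beta>\<close> with the minimum of the block of \<open>\<beta>\<close> containing it.
\<close>

locale ascending_path =
  fixes n k :: nat and f :: "nat \<Rightarrow> wpartition"
  assumes k: "0 < k"
    and step: "\<And>i. i < k \<Longrightarrow> merge_step n (f i) (f (Suc i))"
    and asc: "\<And>i. Suc i < k \<Longrightarrow> label_le (f i) (f (Suc i)) (f (Suc i)) (f (Suc (Suc i)))"
begin

lemma path_wp: "i \<le> k \<Longrightarrow> f i \<in> weighted_partitions n"
  using step[of i] step[of "i - 1"] k merge_step_weighted_partitions by (cases "i = k") auto

lemma path_order:
  assumes "i \<le> k"
  shows "(f i, f k) \<in> weighted_partition_order n"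
proof -
  have "(merge_step n)\<^sup>*\<^sup>* (f i) (f k)"
    using assms
  proof (induction rule: inc_induct)
    case (step j)
    then show ?case
      using ascending_path.step[OF ascending_path_axioms, of j] by (meson converse_rtranclp_into_rtranclp)
  qed simp
  then show ?thesis
    using rtranclp_merge_step_imp_order path_wp by blast
qed

lemma label_le_path:
  assumes "i < j" "j < k"
  shows "label_le (f i) (f (Suc i)) (f j) (f (Suc j))"
  using assms
proof (induction j)
  case (Suc j)
  show ?case
  proof (cases "i = j")
    case False
    then have "label_le (f i) (f (Suc i)) (f j) (f (Suc j))"
      using Suc by simp
    then show ?thesis
      using asc[OF Suc.prems(2)] unfolding label_le_def by linarith
  qed (use asc Suc in simp)
qed simp

lemma block_mins_step:
  assumes "i < k"
  shows "block_mins (f (Suc i)) = block_mins (f i) - {label_b (f i) (f (Suc i))}"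
    and "label_b (f i) (f (Suc i)) \<in> block_mins (f i)"
    and "label_a (f i) (f (Suc i)) \<in> block_mins (f (Suc i))"
    and "label_a (f i) (f (Suc i)) < label_b (f i) (f (Suc i))"
proof -
  obtain p q where pq: "p \<in> f i" "q \<in> f i" "Min (fst p) < Min (fst q)"
    "f (Suc i) = merge (f i) p q (label_u (f i) (f (Suc i)))"
    and ab: "label_a (f i) (f (Suc i)) = Min (fst p)" "label_b (f i) (f (Suc i)) = Min (fst q)"
    using step[OF assms] by (rule merge_stepE)
  have "f i \<in> weighted_partitions n"
    using assms by (intro path_wp) simp
  then show *: "block_mins (f (Suc i)) = block_mins (f i) - {label_b (f i) (f (Suc i))}"
    using block_mins_merge(1)[OF _ pq(1-3)] pq(4) unfolding ab by metis
  show "label_b (f i) (f (Suc i)) \<in> block_mins (f i)"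
    using pq by (auto simp: ab block_mins_def)
  show "label_a (f i) (f (Suc i)) < label_b (f i) (f (Suc i))"
    using pq by (simp add: ab)
  then show "label_a (f i) (f (Suc i)) \<in> block_mins (f (Suc i))"
    unfolding * using pq by (auto simp: ab block_mins_def)
qed

lemma block_mins_path:
  assumes "i \<le> j" "j \<le> k"
  shows "block_mins (f j) = block_mins (f i) - (\<lambda>m. label_b (f m) (f (Suc m))) ` {i..<j}"
  using assms
proof (induction j rule: dec_induct)
  case (step j)
  then show ?case
    using block_mins_step(1)[of j] by (auto simp: atLeastLessThanSuc)
qed simp

text \<open>A minimum absorbed at a later step is the \<open>b\<close> of that step, whose
  \<open>a\<close> is smaller still; but \<open>a\<close> never decreases along an ascending
  path.\<close>

lemma label_a_final:
  assumes i: "i < k"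
  shows "label_a (f i) (f (Suc i)) \<in> block_mins (f k)"
proof (rule ccontr)
  assume "\<not> ?thesis"
  then obtain j where j: "Suc i \<le> j" "j < k" "label_a (f i) (f (Suc i)) = label_b (f j) (f (Suc j))"
    using block_mins_path[of "Suc i" k] block_mins_step(3)[OF i] i by auto
  then show False
    using block_mins_step(4)[of j] label_le_path[of i j] by (auto simp: label_le_def)
qed

lemma merged_blocks:
  assumes i: "i < k"
  obtains p q s where "p \<in> f i" "q \<in> f i" "p \<noteq> q" "s \<in> f k" "fst p \<subseteq> fst s" "fst q \<subseteq> fst s"
    "f (Suc i) = merge (f i) p q (label_u (f i) (f (Suc i)))"
    "Min (fst p) = label_a (f i) (f (Suc i))" "Min (fst q) = label_b (f i) (f (Suc i))"
    "Min (fst s) = label_a (f i) (f (Suc i))"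
proof -
  obtain p q where pq: "p \<in> f i" "q \<in> f i" "p \<noteq> q" "Min (fst p) < Min (fst q)"
    "f (Suc i) = merge (f i) p q (label_u (f i) (f (Suc i)))"
    and ab: "label_a (f i) (f (Suc i)) = Min (fst p)" "label_b (f i) (f (Suc i)) = Min (fst q)"
    using step[OF i] by (rule merge_stepE)
  have fi: "f i \<in> weighted_partitions n" and fk: "f k \<in> weighted_partitions n"
    using i by (auto intro: path_wp)
  have "(fst p \<union> fst q, snd p + snd q + label_u (f i) (f (Suc i))) \<in> f (Suc i)"
    by (subst pq(5)) (simp add: merge_def)
  moreover have "(f (Suc i), f k) \<in> weighted_partition_order n"
    using i by (intro path_order) simp
  ultimately obtain s where s: "s \<in> f k" "fst p \<union> fst q \<subseteq> fst s"
    unfolding weighted_partition_order_iff by fastforce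
  obtain t where t: "t \<in> f k" "Min (fst p) = Min (fst t)"
    using label_a_final[OF i] by (auto simp: ab block_mins_def)
  have "s = t"
    using wp_unique[OF fk s(1) t(1), of "Min (fst p)"] s(2) t(2)
      wp_block(5)[OF fi pq(1)] wp_block(5)[OF fk t(1)] by auto
  then show thesis
    using that[of p q s] pq ab s t by simp
qed

lemma label_a_eq_min_of_block:
  assumes i: "i < k"
  shows "label_a (f i) (f (Suc i)) = min_of_block (f k) (label_b (f i) (f (Suc i)))"
  using i
proof (rule merged_blocks)
  fix p q s assume *: "q \<in> f i" "s \<in> f k" "fst q \<subseteq> fst s"
    "Min (fst q) = label_b (f i) (f (Suc i))" "Min (fst s) = label_a (f i) (f (Suc i))"
  have "f i \<in> weighted_partitions n"
    using i by (auto intro: path_wp)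
  then have "label_b (f i) (f (Suc i)) \<in> fst s"
    using wp_block(5)[of "f i" n q] * by auto
  then show ?thesis
    using min_of_block_eq[of "f k" n s] path_wp[of k] * by simp
qed

lemma first_label_b: "label_b (f 0) (f (Suc 0)) \<in> block_mins (f 0) - block_mins (f k)"
  using block_mins_path[of 0 k] block_mins_step(2)[OF k] k by auto

text \<open>Such a \<open>b\<close> is absorbed at some step, whose label is
  \<open>(min_of_block (f k) b, b)\<close> up to the increment, and the first label precedes it. The
  first pair is therefore the least one computable from the two ends.\<close>

lemma first_label_least:
  assumes "b \<in> block_mins (f 0) - block_mins (f k)"
  shows "label_a (f 0) (f (Suc 0)) < min_of_block (f k) b \<or>
    label_a (f 0) (f (Suc 0)) = min_of_block (f k) b \<and> label_b (f 0) (f (Suc 0)) \<le> b"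
proof -
  obtain i where i: "i < k" "b = label_b (f i) (f (Suc i))"
    using assms block_mins_path[of 0 k] by auto
  then show ?thesis
    using label_le_path[of 0 i] label_a_eq_min_of_block[of i]
    by (cases "i = 0") (auto simp: label_le_def)
qed

text \<open>All merges inside \<open>s\<close> share the same \<open>a\<close>, so after a first
  increment 1 their increments are all 1. Each one then raises the weight inside \<open>s\<close> by
  one and lowers the number of blocks by one, leaving the sum constant. The weight of
  \<open>s\<close> is thus the largest admissible one.\<close>

lemma final_weight:
  assumes s: "s \<in> f k" "Min (fst s) = label_a (f 0) (f (Suc 0))"
    and u: "0 < label_u (f 0) (f (Suc 0))"
  shows "Suc (snd s) = weight_below (f 0) (fst s) + card (below (f 0) (fst s))"
proof -
  have fk: "f k \<in> weighted_partitions n"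
    by (rule path_wp) simp
  let ?c = "\<lambda>i. weight_below (f i) (fst s) + card (below (f i) (fst s))"
  have step_eq: "?c (Suc i) = ?c i" if i: "i < k" for i
    using i
  proof (rule merged_blocks)
    fix p q t assume pq: "p \<in> f i" "q \<in> f i" "p \<noteq> q" and t: "t \<in> f k" "fst p \<subseteq> fst t" "fst q \<subseteq> fst t"
      and eq: "f (Suc i) = merge (f i) p q (label_u (f i) (f (Suc i)))"
      and tm: "Min (fst t) = label_a (f i) (f (Suc i))"
    have fi: "f i \<in> weighted_partitions n"
      using i by (intro path_wp) simp
    show ?thesis
    proof (cases "t = s")
      case True
      then have "label_u (f 0) (f (Suc 0)) \<le> label_u (f i) (f (Suc i))"
        using label_le_path[of 0 i] i tm s(2) by (cases "i = 0") (auto simp: label_le_def)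
      moreover have "label_u (f i) (f (Suc i)) \<le> 1"
        using step[OF i] by (rule merge_stepE)
      ultimately have "label_u (f i) (f (Suc i)) = 1"
        using u by simp
      then have "f (Suc i) = merge (f i) p q 1"
        using eq by simp
      then show ?thesis
        using below_merge_in[OF fi pq, of "fst s" 1] t True by simp
    next
      case False
      then have "fst t \<inter> fst s = {}"
        using wp_unique[OF fk t(1) s(1)] by blast
      then have "\<not> fst p \<subseteq> fst s" "\<not> fst q \<subseteq> fst s"
        using t wp_block(1)[OF fi pq(1)] wp_block(1)[OF fi pq(2)] by blast+
      then have "below (f (Suc i)) (fst s) = below (f i) (fst s)"
        using below_merge_out[OF fi pq] eq by metis
      then show ?thesis
        by (simp add: weight_below_def)
    qed
  qed
  \<comment> \<open>At the end \<open>s\<close> is the only block inside itself, so the constant sum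
    equals the weight of \<open>s\<close> plus one.\<close>
  have const: "?c i = ?c 0" if "i \<le> k" for i
    using that by (induction i) (use step_eq in auto)
  have "?c k = ?c 0"
    by (rule const) simp
  then show ?thesis
    using below_block[OF fk s(1)] by (simp add: weight_below_def)
qed

end

text \<open>Both first pairs are the least pair \<open>(min_of_block b, b)\<close> over the minima
  \<open>b\<close> that disappear. Only the blocks of the last partitions are compared, so that this
  also covers chains to the maximum, where the weights below the last step are not known to
  agree.\<close>

lemma ascending_paths_first_label:
  assumes f: "ascending_path n k f" and g: "ascending_path n k g"
    and "f 0 = g 0" and top: "fst ` f k = fst ` g k"
  shows "label_a (f 0) (f (Suc 0)) = label_a (g 0) (g (Suc 0))"
    and "label_b (f 0) (f (Suc 0)) = label_b (g 0) (g (Suc 0))"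
proof -
  interpret f: ascending_path n k f by (rule f)
  interpret g: ascending_path n k g by (rule g)
  have mins: "block_mins (f k) = block_mins (g k)"
    using arg_cong[OF top, of "\<lambda>A. Min ` A"] by (simp add: block_mins_def image_image)
  have mob: "min_of_block (f k) = min_of_block (g k)"
    by (simp add: min_of_block_def top fun_eq_iff)
  have "label_b (g 0) (g (Suc 0)) \<in> block_mins (f 0) - block_mins (f k)"
    unfolding mins \<open>f 0 = g 0\<close> by (rule g.first_label_b)
  note 1 = f.first_label_least[OF this, unfolded mob, folded g.label_a_eq_min_of_block[OF f.k]]
  have "label_b (f 0) (f (Suc 0)) \<in> block_mins (g 0) - block_mins (g k)"
    unfolding mins[symmetric] \<open>f 0 = g 0\<close>[symmetric] by (rule f.first_label_b)
  note 2 = g.first_label_least[OF this, folded mob, folded f.label_a_eq_min_of_block[OF f.k]]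
  show "label_a (f 0) (f (Suc 0)) = label_a (g 0) (g (Suc 0))"
    "label_b (f 0) (f (Suc 0)) = label_b (g 0) (g (Suc 0))"
    using 1 2 by linarith+
qed

text \<open>By \<open>final_weight\<close>, a first increment 1 in \<open>f\<close> puts the target
  weight at the top of its range. A first increment 0 in \<open>g\<close>, in the same target block,
  would remove that value from the range.\<close>

lemma ascending_paths_label_u:
  assumes f: "ascending_path n k f" and g: "ascending_path n k g"
    and 0: "f 0 = g 0" and k: "f k = g k" and u: "0 < label_u (f 0) (f (Suc 0))"
  shows "0 < label_u (g 0) (g (Suc 0))"
proof (rule ccontr)
  assume "\<not> ?thesis"
  interpret f: ascending_path n k f by (rule f)
  interpret g: ascending_path n k g by (rule g)
  have "fst ` f k = fst ` g k"
    by (simp add: k)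
  note a = ascending_paths_first_label(1)[OF f g 0 this]
  show False
    using f.k
  proof (rule g.merged_blocks)
    fix p q s assume pq: "p \<in> g 0" "q \<in> g 0" "p \<noteq> q" and s: "s \<in> g k" "fst p \<subseteq> fst s" "fst q \<subseteq> fst s"
      and eq: "g (Suc 0) = merge (g 0) p q (label_u (g 0) (g (Suc 0)))"
      and sm: "Min (fst s) = label_a (g 0) (g (Suc 0))"
    have "g (Suc 0) = merge (g 0) p q 0"
      using eq \<open>\<not> 0 < label_u (g 0) (g (Suc 0))\<close> by simp
    then have "weight_below (g (Suc 0)) (fst s) = weight_below (g 0) (fst s)"
      "Suc (card (below (g (Suc 0)) (fst s))) = card (below (g 0) (fst s))"
      using below_merge_in[OF g.path_wp[of 0] pq s(2,3), of 0] by simp_all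
    moreover have "snd s < weight_below (g (Suc 0)) (fst s) + card (below (g (Suc 0)) (fst s))"
      using g.path_order[of "Suc 0"] g.k s(1) by (simp add: weighted_partition_order_iff)
    moreover have "Suc (snd s) = weight_below (f 0) (fst s) + card (below (f 0) (fst s))"
      using s(1) sm u by (intro f.final_weight) (simp_all add: k a)
    ultimately show False
      by (simp add: 0)
  qed
qed

lemma merge_step_determined:
  assumes "merge_step n \<alpha> \<beta>" "merge_step n \<alpha> \<gamma>" "label_a \<alpha> \<beta> = label_a \<alpha> \<gamma>"
    "label_b \<alpha> \<beta> = label_b \<alpha> \<gamma>" "label_u \<alpha> \<beta> = label_u \<alpha> \<gamma>"
  shows "\<beta> = \<gamma>"
proof -
  have \<alpha>: "\<alpha> \<in> weighted_partitions n"
    using assms(1) by (simp add: merge_step_def)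
  obtain p q where pq: "p \<in> \<alpha>" "q \<in> \<alpha>" "\<beta> = merge \<alpha> p q (label_u \<alpha> \<beta>)"
    "label_a \<alpha> \<beta> = Min (fst p)" "label_b \<alpha> \<beta> = Min (fst q)"
    using assms(1) by (rule merge_stepE)
  obtain r s where rs: "r \<in> \<alpha>" "s \<in> \<alpha>" "\<gamma> = merge \<alpha> r s (label_u \<alpha> \<gamma>)"
    "label_a \<alpha> \<gamma> = Min (fst r)" "label_b \<alpha> \<gamma> = Min (fst s)"
    using assms(2) by (rule merge_stepE)
  have "p = r" "q = s"
    using pq rs assms by (auto intro: wp_Min_inj[OF \<alpha>])
  then show ?thesis
    using pq(3) rs(3) assms(5) by simp
qed

section \<open>The poset with a maximum\<close>

fun top_cover :: "nat \<Rightarrow> wpartition option \<Rightarrow> wpartition option \<Rightarrow> bool" where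
  "top_cover n (Some \<alpha>) (Some \<beta>) = merge_step n \<alpha> \<beta>"
| "top_cover n (Some \<alpha>) None = (\<alpha> \<in> weighted_partitions n \<and> card \<alpha> = 1)"
| "top_cover n None y = False"

text \<open>A merge lowers the number of blocks by one, and a single block, of rank -1, lies
  directly below the maximum, of rank 0.\<close>

fun top_rank :: "wpartition option \<Rightarrow> int" where
  "top_rank (Some \<alpha>) = - int (card \<alpha>)"
| "top_rank None = 0"

text \<open>The value 0 for a step to the maximum is harmless: what has to drop at a descent is the
  label of its lower step, and that step never ends in the maximum.\<close>

fun top_label :: "nat \<Rightarrow> wpartition option \<Rightarrow> wpartition option \<Rightarrow> nat" where
  "top_label n (Some \<alpha>) (Some \<beta>) = label_code n \<alpha> \<beta>"
| "top_label n x y = 0"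

text \<open>The last step, from a single block to the maximum, behaves like a step with label \<open>(1, n + 1, 0)\<close>.\<close>

fun top_ascent :: "wpartition option \<Rightarrow> wpartition option \<Rightarrow> wpartition option \<Rightarrow> bool" where
  "top_ascent (Some \<alpha>) (Some \<beta>) (Some \<gamma>) = label_le \<alpha> \<beta> \<beta> \<gamma>"
| "top_ascent (Some \<alpha>) (Some \<beta>) None = (label_u \<alpha> \<beta> = 0)"
| "top_ascent x y z = True"

lemma top_cover_Some: "top_cover n x y \<Longrightarrow> \<exists>\<alpha>\<in>weighted_partitions n. x = Some \<alpha>"
  by (cases x; cases y) (auto dest: merge_step_weighted_partitions)

lemma top_descent:
  assumes "top_cover n x y" "top_cover n y z" "\<not> top_ascent x y z"
  shows "\<exists>y'. top_cover n x y' \<and> top_cover n y' z \<and> top_label n x y' < top_label n x y"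
proof -
  obtain \<alpha> \<beta> where xy: "x = Some \<alpha>" "y = Some \<beta>"
    using top_cover_Some[OF assms(1)] top_cover_Some[OF assms(2)] by blast
  then have step: "merge_step n \<alpha> \<beta>"
    using assms(1) by simp
  show ?thesis
  proof (cases z)
    case (Some \<gamma>)
    then have "merge_step n \<beta> \<gamma>" "\<not> label_le \<alpha> \<beta> \<beta> \<gamma>"
      using assms xy by auto
    from merge_step_descent[OF step this] obtain \<beta>' where
      "merge_step n \<alpha> \<beta>'" "merge_step n \<beta>' \<gamma>" "label_code n \<alpha> \<beta>' < label_code n \<alpha> \<beta>"
      by blast
    then show ?thesis
      using xy Some by (intro exI[of _ "Some \<beta>'"]) simp
  next
    case None
    have \<alpha>: "\<alpha> \<in> weighted_partitions n"
      using step by (simp add: merge_step_def)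
    obtain p q where pq: "p \<in> \<alpha>" "q \<in> \<alpha>" "Min (fst p) < Min (fst q)"
      and ab: "label_a \<alpha> \<beta> = Min (fst p)" "label_b \<alpha> \<beta> = Min (fst q)"
      using step by (rule merge_stepE)
    \<comment> \<open>A descent just below the maximum means increment 1. The same merge with
      increment 0 also leaves a single block, which the maximum covers as well.\<close>
    let ?\<beta> = "merge \<alpha> p q 0"
    note l = label_merge[OF \<alpha> pq _ refl, of 0, simplified]
    have step': "merge_step n \<alpha> ?\<beta>"
      using \<alpha> pq by (intro merge_step_mergeI) auto
    have "label_code n \<alpha> ?\<beta> < label_code n \<alpha> \<beta>"
      using wp_block(7)[OF \<alpha> pq(2)] assms(3) xy None
      by (intro label_code_less) (auto simp: l ab)
    moreover have "card ?\<beta> = 1" "?\<beta> \<in> weighted_partitions n"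
      using merge_step_card[OF step] merge_step_card[OF step'] assms(2) xy None
        merge_step_weighted_partitions(2)[OF step'] by auto
    ultimately show ?thesis
      using step' xy None by (intro exI[of _ "Some ?\<beta>"]) simp
  qed
qed

lemma single_block:
  assumes "\<alpha> \<in> weighted_partitions n" "card \<alpha> = 1"
  shows "fst ` \<alpha> = {{1..n}}"
proof -
  obtain p where "\<alpha> = {p}"
    using assms(2) card_1_singletonE by blast
  then show ?thesis
    using assms(1) by (auto simp: weighted_partitions_iff)
qed

text \<open>A chain that stays below the maximum is an ascending path between fixed ends. A chain to
  the maximum is one after its last step is cut off; its end then has unknown weight but the single
  block {1..n}, and the ascent condition at the maximum determines the first increment
  instead.\<close>

lemma top_ascending_unique:
  assumes k: "0 < k" and 0: "f 0 = g 0" and fgk: "f k = g k"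
    and f: "\<And>i. i < k \<Longrightarrow> top_cover n (f i) (f (Suc i))"
    and g: "\<And>i. i < k \<Longrightarrow> top_cover n (g i) (g (Suc i))"
    and af: "\<And>i. Suc i < k \<Longrightarrow> top_ascent (f i) (f (Suc i)) (f (Suc (Suc i)))"
    and ag: "\<And>i. Suc i < k \<Longrightarrow> top_ascent (g i) (g (Suc i)) (g (Suc (Suc i)))"
  shows "f (Suc 0) = g (Suc 0)"
proof -
  have path: "ascending_path n m (\<lambda>i. the (h i))"
    if h: "\<And>i. i < k \<Longrightarrow> top_cover n (h i) (h (Suc i))"
      and ah: "\<And>i. Suc i < k \<Longrightarrow> top_ascent (h i) (h (Suc i)) (h (Suc (Suc i)))"
      and m: "0 < m" "m \<le> k" and some: "\<And>i. i \<le> m \<Longrightarrow> h i \<noteq> None" for h m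
  proof
    fix i
    show "merge_step n (the (h i)) (the (h (Suc i)))" if "i < m"
      using h[of i] some[of i] some[of "Suc i"] that m by auto
    show "label_le (the (h i)) (the (h (Suc i))) (the (h (Suc i))) (the (h (Suc (Suc i))))" if "Suc i < m"
      using ah[of i] some[of i] some[of "Suc i"] some[of "Suc (Suc i)"] that m by auto
  qed (rule m)
  have somef: "f i \<noteq> None" and someg: "g i \<noteq> None" if "i < k" for i
    using top_cover_Some[OF f[OF that]] top_cover_Some[OF g[OF that]] by auto
  let ?f = "\<lambda>i. the (f i)" and ?g = "\<lambda>i. the (g i)"
  have determined: ?thesis
    if pf: "ascending_path n m ?f" and pg: "ascending_path n m ?g" and "fst ` ?f m = fst ` ?g m"
      and u: "label_u (?f 0) (?f (Suc 0)) = label_u (?g 0) (?g (Suc 0))"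
      and some: "f (Suc 0) \<noteq> None" "g (Suc 0) \<noteq> None" for m
  proof -
    have eq: "?f 0 = ?g 0"
      by (simp add: 0)
    have "?f (Suc 0) = ?g (Suc 0)"
    proof (rule merge_step_determined)
      show "merge_step n (?f 0) (?f (Suc 0))" "merge_step n (?f 0) (?g (Suc 0))"
        using ascending_path.step[OF pf ascending_path.k[OF pf]]
          ascending_path.step[OF pg ascending_path.k[OF pg]] by (simp_all add: eq)
    qed (use ascending_paths_first_label[OF pf pg eq that(3)] u in \<open>simp_all add: eq\<close>)
    then show ?thesis
      using some by auto
  qed
  show ?thesis
  proof (cases "f k")
    case (Some \<beta>)
    have sf: "f i \<noteq> None" and sg: "g i \<noteq> None" if "i \<le> k" for i
      using somef someg that Some fgk by (cases "i = k"; simp)+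
    have pf: "ascending_path n k ?f"
      using f af k order_refl sf by (rule path)
    have pg: "ascending_path n k ?g"
      using g ag k order_refl sg by (rule path)
    have "label_u (?f 0) (?f (Suc 0)) \<le> 1" "label_u (?g 0) (?g (Suc 0)) \<le> 1"
      using ascending_path.step[OF pf k] ascending_path.step[OF pg k] by (auto elim: merge_stepE)
    moreover have "0 < label_u (?f 0) (?f (Suc 0)) \<longleftrightarrow> 0 < label_u (?g 0) (?g (Suc 0))"
      using ascending_paths_label_u[OF pf pg] ascending_paths_label_u[OF pg pf] by (auto simp: 0 fgk)
    ultimately have "label_u (?f 0) (?f (Suc 0)) = label_u (?g 0) (?g (Suc 0))"
      by linarith
    then show ?thesis
      using pf pg sf sg k by (intro determined[of k]) (auto simp: fgk)
  next
    case None
    show ?thesis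
    proof (cases "k = 1")
      case True
      then show ?thesis
        using fgk by simp
    next
      case False
      then obtain m where m: "k = Suc m" "0 < m"
        using k by (cases k) auto
      have pf: "ascending_path n m ?f"
        using f af m(2) by (rule path) (use m somef in auto)
      have pg: "ascending_path n m ?g"
        using g ag m(2) by (rule path) (use m someg in auto)
      have last_block: "fst ` the (h m) = {{1..n}}"
        if h: "top_cover n (h m) (h (Suc m))" "h (Suc m) = None" "h m \<noteq> None" for h
      proof -
        obtain \<alpha> where "h m = Some \<alpha>"
          using h(3) by blast
        then show ?thesis
          using h(1,2) single_block[of \<alpha> n] by simp
      qed
      \<comment> \<open>With only one block left at the end, every \<open>a\<close> is the minimum
        of {1..n}, so the increments never decrease; as the last one is 0, so is the first.\<close>
      have u0: "label_u (the (h 0)) (the (h (Suc 0))) = 0"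
        if ph: "ascending_path n m (\<lambda>i. the (h i))" and last: "fst ` the (h m) = {{1..n}}"
          and top_asc: "top_ascent (h (m - 1)) (h m) None" and some: "h (m - 1) \<noteq> None" "h m \<noteq> None" for h
      proof -
        interpret ascending_path n m "\<lambda>i. the (h i)"
          by (rule ph)
        have "label_a (the (h i)) (the (h (Suc i))) = Min {1..n}" if "i < m" for i
        proof -
          have "label_a (the (h i)) (the (h (Suc i))) \<in> block_mins (the (h m))"
            by (rule label_a_final[OF that])
          also have "block_mins (the (h m)) = Min ` fst ` the (h m)"
            by (simp add: block_mins_def image_image)
          finally show ?thesis
            by (simp add: last)
        qed
        moreover have "label_u (the (h (m - 1))) (the (h m)) = 0"
          using top_asc some by auto
        ultimately show ?thesis
          using label_le_path[of 0 "m - 1"] m(2)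
          by (cases m; cases "m = 1") (auto simp: label_le_def)
      qed
      have lf: "fst ` ?f m = {{1..n}}"
        by (rule last_block) (use f[of m] somef[of m] None m in auto)
      have lg: "fst ` ?g m = {{1..n}}"
        by (rule last_block) (use g[of m] someg[of m] None fgk m in auto)
      have "label_u (?f 0) (?f (Suc 0)) = 0"
        by (rule u0[OF pf lf]) (use af[of "m - 1"] somef None m in auto)
      moreover have "label_u (?g 0) (?g (Suc 0)) = 0"
        by (rule u0[OF pg lg]) (use ag[of "m - 1"] someg None fgk m in auto)
      ultimately show ?thesis
        using somef[of "Suc 0"] someg[of "Suc 0"] m by (intro determined[OF pf pg]) (simp_all add: lf lg)
    qed
  qed
qed

interpretation weighted: lexicographic_covers "insert None (Some ` weighted_partitions n)" "top_cover n"
  top_rank "top_label n" top_ascent for n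
proof
  show "finite (insert None (Some ` weighted_partitions n))"
    by (simp add: finite_weighted_partitions)
  show "x \<in> insert None (Some ` weighted_partitions n) \<and> y \<in> insert None (Some ` weighted_partitions n)"
    "top_rank y = top_rank x + 1" if "top_cover n x y" for x y
    using that by (cases x; cases y; force dest: merge_step_weighted_partitions merge_step_card)+
qed (fact top_descent, rule top_ascending_unique)

section \<open>The given order as the order generated by covers\<close>

lemma rtranclp_top_cover_Some: "(merge_step n)\<^sup>*\<^sup>* \<alpha> \<beta> \<Longrightarrow> (top_cover n)\<^sup>*\<^sup>* (Some \<alpha>) (Some \<beta>)"
  by (induction rule: rtranclp_induct) (auto intro: rtranclp.rtrancl_into_rtrancl)

lemma rtranclp_top_cover_SomeD:
  assumes "(top_cover n)\<^sup>*\<^sup>* x (Some \<beta>)"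
  shows "\<exists>\<alpha>. x = Some \<alpha> \<and> (merge_step n)\<^sup>*\<^sup>* \<alpha> \<beta>"
  using assms
proof (induction rule: converse_rtranclp_induct)
  case (step x y)
  then obtain \<gamma> where "y = Some \<gamma>" "(merge_step n)\<^sup>*\<^sup>* \<gamma> \<beta>"
    by blast
  with step(1) show ?case
    by (cases x) (auto intro: converse_rtranclp_into_rtranclp)
qed auto

text \<open>Merging with increment 0 is possible until one block remains. For \<open>n = 0\<close>
  the only partition has no block at all, and no chain of covers would lead from it to the
  maximum.\<close>

lemma rtranclp_top_cover_None:
  assumes "1 \<le> n" "\<alpha> \<in> weighted_partitions n"
  shows "(top_cover n)\<^sup>*\<^sup>* (Some \<alpha>) None"
  using assms(2)
proof (induction "card \<alpha>" arbitrary: \<alpha> rule: less_induct)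
  case less
  note \<alpha> = less.prems
  have "\<alpha> \<noteq> {}"
    using \<alpha> assms(1) by (auto simp: weighted_partitions_iff)
  then obtain p where p: "p \<in> \<alpha>"
    by blast
  show ?case
  proof (cases "\<alpha> = {p}")
    case True
    then show ?thesis
      using \<alpha> by auto
  next
    case False
    then obtain q where "q \<in> \<alpha>" "p \<noteq> q"
      using p by blast
    then have "Min (fst p) \<noteq> Min (fst q)"
      using wp_Min_inj[OF \<alpha> p] by blast
    then obtain p' q' where "p' \<in> \<alpha>" "q' \<in> \<alpha>" "Min (fst p') < Min (fst q')"
      using p \<open>q \<in> \<alpha>\<close> by (metis linorder_neqE_nat)
    then have step: "merge_step n \<alpha> (merge \<alpha> p' q' 0)"
      using \<alpha> by (intro merge_step_mergeI) auto
    then have "(top_cover n)\<^sup>*\<^sup>* (Some (merge \<alpha> p' q' 0)) None"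
      using less.hyps merge_step_card merge_step_weighted_partitions(2) by simp
    with step show ?thesis
      by (intro converse_rtranclp_into_rtranclp[of _ "Some \<alpha>"]) auto
  qed
qed

lemma weighted_partition_order_top_eq:
  assumes "1 \<le> n"
  shows "weighted_partition_order_top n = weighted.ord n"
proof (rule Set.set_eqI)
  fix z :: "wpartition option \<times> wpartition option"
  obtain x y where z: "z = (x, y)"
    by (cases z)
  show "z \<in> weighted_partition_order_top n \<longleftrightarrow> z \<in> weighted.ord n"
  proof (cases y)
    case None
    then show ?thesis
      using rtranclp_top_cover_None[OF assms]
      by (auto simp: z weighted_partition_order_top_def adjoin_top_def weighted.ord_def)
  next
    case (Some \<beta>)
    then show ?thesis
      using rtranclp_top_cover_Some[of n _ \<beta>] rtranclp_top_cover_SomeD[of n x \<beta>]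
      by (auto simp: z weighted_partition_order_top_def adjoin_top_def weighted.ord_def
          weighted_partition_order_eq_rtranclp)
  qed
qed

theorem corollary3p5:
  fixes n :: nat
  assumes "n \<ge> 1"
  shows "Cohen_Macaulay TYPE('k::field) (weighted_partition_order_top n) \<and>
         Cohen_Macaulay TYPE(int) (weighted_partition_order_top n)"
  unfolding weighted_partition_order_top_eq[OF assms]
  by (intro conjI weighted.Cohen_Macaulay_ord)

end
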